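(* Let $K$ be a convex compactum and let $B\subset K$ be a boundary of $K$. If $B$ is a Lindelöf $\Sigma$-space, then $w(K)\le nw(B)$.
   Context: All spaces are Tychonoff. A convex compactum is a compact convex subset of a (Hausdorff, real) locally convex linear space. $\mathcal A(K)$ denotes the set of continuous affine functions $f\colon K\to\mathbb R$. A set $B\subset K$ is a boundary of $K$ if for every $f\in\mathcal A(K)$ there is $b\in B$ with $f(b)=\max_{x\in K}f(x)$. A map is perfect if it is continuous, closed, and has compact point-preimages. A space is a Lindelöf $p$-space if it can be perfectly mapped onto a space with a countable base; a Lindelöf $\Sigma$-space is a continuous image of a Lindelöf $p$-space. $w(X)$ is the weight: the minimal cardinality of a base of $X$, plus $\omega$. A network of $X$ is a family $\mathcal N$ of subsets such that each open set is the union of a subfamily of $\mathcal N$; $nw(X)$ is the minimal cardinality of a network of $X$, plus $\omega$. *)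

theory Defs
  imports "HOL-Analysis.Analysis"
begin

unbundle cardinal_syntax

definition tychonoff_space :: "'a topology \<Rightarrow> bool" where
  "tychonoff_space X \<longleftrightarrow> completely_regular_space X \<and> Hausdorff_space X"


subsection \<open>Convex compacta and boundaries\<close>

text \<open>Linear topologies are values of type \<open>'a topology\<close> on the whole of a \<open>real_vector\<close>
  type, since no topological type class of the library describes general locally convex spaces.\<close>

definition locally_convex_linear_space :: "'a::real_vector topology \<Rightarrow> bool" where
  "locally_convex_linear_space T \<longleftrightarrow>
     topspace T = UNIV \<and> Hausdorff_space T \<and>
     continuous_map (prod_topology T T) T (\<lambda>(x, y). x + y) \<and>
     continuous_map (prod_topology euclideanreal T) T (\<lambda>(c, x). c *\<^sub>R x) \<and>
     (\<forall>U. openin T U \<and> 0 \<in> U \<longrightarrow> (\<exists>V. openin T V \<and> convex V \<and> 0 \<in> V \<and> V \<subseteq> U))"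

definition convex_compactum :: "'a::real_vector topology \<Rightarrow> 'a set \<Rightarrow> bool" where
  "convex_compactum T K \<longleftrightarrow>
     locally_convex_linear_space T \<and> compactin T K \<and> convex K"

text \<open>Members of the following set are total functions; only their values on \<open>K\<close> matter.\<close>

definition continuous_affine_functions ::
    "'a::real_vector topology \<Rightarrow> 'a set \<Rightarrow> ('a \<Rightarrow> real) set" where
  "continuous_affine_functions T K =
     {f. continuous_map (subtopology T K) euclideanreal f \<and>
         (\<forall>x\<in>K. \<forall>y\<in>K. \<forall>t\<in>{0..1}.
            f ((1 - t) *\<^sub>R x + t *\<^sub>R y) = (1 - t) * f x + t * f y)}"

definition boundary_of :: "'a::real_vector topology \<Rightarrow> 'a set \<Rightarrow> 'a set \<Rightarrow> bool" where
  "boundary_of T K B \<longleftrightarrow>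
     B \<subseteq> K \<and> (\<forall>f\<in>continuous_affine_functions T K. \<exists>b\<in>B. \<forall>x\<in>K. f x \<le> f b)"


subsection \<open>Lindelof p-spaces and Lindelof Sigma-spaces\<close>

text \<open>Existential quantification over spaces would range over types, so the carrier types of the
  auxiliary spaces are parameters. In the hypotheses of a theorem these should be free type
  variables: being universally quantified outside, they then allow arbitrary carriers.\<close>

definition Lindelof_p_space :: "'m itself \<Rightarrow> 'a topology \<Rightarrow> bool" where
  "Lindelof_p_space _ X \<longleftrightarrow>
     tychonoff_space X \<and>
     (\<exists>(M :: 'm topology) p. tychonoff_space M \<and> second_countable M \<and> perfect_map X M p)"

definition Lindelof_Sigma_space :: "'l itself \<Rightarrow> 'm itself \<Rightarrow> 'a topology \<Rightarrow> bool" where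
  "Lindelof_Sigma_space _ _ X \<longleftrightarrow>
     tychonoff_space X \<and>
     (\<exists>(L :: 'l topology) f. Lindelof_p_space TYPE('m) L \<and>
        continuous_map L X f \<and> f ` topspace L = topspace X)"


subsection \<open>Weight and network weight\<close>

definition base_of :: "'a topology \<Rightarrow> 'a set set \<Rightarrow> bool" where
  "base_of X \<B> \<longleftrightarrow>
     (\<forall>V\<in>\<B>. openin X V) \<and> (\<forall>U. openin X U \<longrightarrow> (\<exists>\<C>\<subseteq>\<B>. U = \<Union>\<C>))"

definition network_of :: "'a topology \<Rightarrow> 'a set set \<Rightarrow> bool" where
  "network_of X \<N> \<longleftrightarrow>
     (\<forall>N\<in>\<N>. N \<subseteq> topspace X) \<and> (\<forall>U. openin X U \<longrightarrow> (\<exists>\<C>\<subseteq>\<N>. U = \<Union>\<C>))"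

definition min_card :: "('a set \<Rightarrow> bool) \<Rightarrow> 'a rel" where
  "min_card P = |SOME A. P A \<and> (\<forall>A'. P A' \<longrightarrow> |A| \<le>o |A'| )|"

lemma min_card:
  assumes "P A\<^sub>0"
  shows "\<exists>A. P A \<and> min_card P = |A|" and "P A' \<Longrightarrow> min_card P \<le>o |A'|"
proof -
  have "\<exists>r\<in>card_of ` Collect P. \<forall>r'\<in>card_of ` Collect P. r \<le>o r'"
    by (rule exists_minim_Card_order) (use assms card_of_Card_order in auto)
  then have "\<exists>A. P A \<and> (\<forall>A'. P A' \<longrightarrow> |A| \<le>o |A'| )"
    by auto
  from someI_ex[OF this]
  show "\<exists>A. P A \<and> min_card P = |A|" and "P A' \<Longrightarrow> min_card P \<le>o |A'|"
    unfolding min_card_def by blast+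
qed

definition weight :: "'a topology \<Rightarrow> ('a set + nat) rel" where
  "weight X = min_card (base_of X) +c natLeq"

definition network_weight :: "'a topology \<Rightarrow> ('a set + nat) rel" where
  "network_weight X = min_card (network_of X) +c natLeq"

lemma base_of_openin: "base_of X {U. openin X U}"
proof -
  have "\<exists>\<C>\<subseteq>{U. openin X U}. U = \<Union>\<C>" if "openin X U" for U
    using that by (intro exI[of _ "{U}"]) simp
  then show ?thesis
    unfolding base_of_def by simp
qed

lemma base_of_imp_network_of: "base_of X \<B> \<Longrightarrow> network_of X \<B>"
  unfolding base_of_def network_of_def by (simp add: openin_subset)

end

theory Submission
  imports Defs "HOL-Library.Countable_Set_Type"
begin

text \<open>Let \<open>\<kappa> = nw(B)\<close>. There are countably many sets \<open>\<M>\<close> and at most \<open>\<kappa>\<close> many sets \<open>\<Q>\<close> in \<open>B\<close> such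
  that, for each continuous function \<open>g\<close> on \<open>B\<close> and each \<open>\<epsilon> > 0\<close>, every point lies in a member of \<open>\<M>\<close>
  that is covered by finitely many members of \<open>\<Q>\<close> on which \<open>g\<close> oscillates by less than \<open>\<epsilon>\<close>. For every
  finite system of constraints ``\<open>g\<close> is within \<open>1/(k+1)\<close> of \<open>q\<close> on \<open>Q\<close>'' that some function in \<open>\<A>(K)\<close> of
  norm at most \<open>m\<close> satisfies, choose one such function. As \<open>\<M>\<close> is countable, every \<open>g\<close> in \<open>\<A>(K)\<close> is a
  pointwise limit on \<open>B\<close> of a bounded \<^emph>\<open>sequence\<close> of chosen functions. By Simons' theorem this
  sequence converges to \<open>g\<close> pointwise on all of \<open>K\<close>, so the at most \<open>\<kappa>\<close> chosen functions separate
  the points of \<open>K\<close>, because \<open>\<A>(K)\<close> does by the Hahn-Banach theorem. Compactness of \<open>K\<close> then bounds its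
  weight.\<close>

subsection \<open>Continuous affine functions separate the points of a convex compactum\<close>

definition sublinear :: "('a::real_vector \<Rightarrow> real) \<Rightarrow> bool" where
  "sublinear p \<longleftrightarrow> (\<forall>x y. p (x + y) \<le> p x + p y) \<and> (\<forall>c\<ge>0. \<forall>x. p (c *\<^sub>R x) = c * p x)"

text \<open>One inequality for positive scalars suffices: applied to \<open>inverse c\<close> and
  \<open>c *\<^sub>R x\<close> it yields the reverse one.\<close>

lemma sublinearI:
  assumes "\<And>x y. p (x + y) \<le> p x + p y" and "p 0 = 0"
    and le: "\<And>c x. c > 0 \<Longrightarrow> p (c *\<^sub>R x) \<le> c * p x"
  shows "sublinear p"
proof -
  have "p (c *\<^sub>R x) = c * p x" if "c \<ge> 0" for c x
  proof (cases "c = 0")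
    case False
    with that have "c > 0" by simp
    with le[of "inverse c" "c *\<^sub>R x"] have "p x \<le> inverse c * p (c *\<^sub>R x)"
      by simp
    then have "c * p x \<le> p (c *\<^sub>R x)"
      using \<open>c > 0\<close> by (simp add: field_simps)
    with le[OF \<open>c > 0\<close>, of x] show ?thesis by simp
  qed (use assms in simp)
  with assms(1) show ?thesis
    by (simp add: sublinear_def)
qed

lemma sublinear_zero: "sublinear p \<Longrightarrow> p 0 = 0"
  unfolding sublinear_def by (metis mult_zero_left order_refl scaleR_zero_left)

lemma sublinear_neg_le: "sublinear p \<Longrightarrow> - p (- x) \<le> p x"
  using sublinear_zero[of p] unfolding sublinear_def
  by (metis add.right_inverse add.commute neg_le_iff_le diff_ge_0_iff_ge diff_minus_eq_add)

text \<open>This supplies the bounds of chains for Zorn's lemma. The common majorant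
  \<open>p\<close> keeps the infimum finite, since every member is at least \<open>- p (- x)\<close>
  at \<open>x\<close>. Subadditivity survives because, of two members of a chain, the smaller one
  serves both arguments at once.\<close>

lemma sublinear_Inf_chain:
  fixes p :: "'a::real_vector \<Rightarrow> real"
  assumes "C \<noteq> {}" and C: "\<And>q. q \<in> C \<Longrightarrow> sublinear q \<and> (\<forall>x. q x \<le> p x)"
    and chain: "\<And>q r. q \<in> C \<Longrightarrow> r \<in> C \<Longrightarrow> (\<forall>x. q x \<le> r x) \<or> (\<forall>x. r x \<le> q x)"
  shows "sublinear (\<lambda>x. INF q\<in>C. q x)" and "q \<in> C \<Longrightarrow> (INF q\<in>C. q x) \<le> q x"
proof -
  have bdd: "bdd_below ((\<lambda>q. q x) ` C)" for x
    by (rule bdd_belowI2[where m = "- p (- x)"])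
      (meson C sublinear_neg_le neg_le_iff_le order_trans)
  have low: "(INF q\<in>C. q x) \<le> q x" if "q \<in> C" for q x
    by (rule cINF_lower[OF bdd that])
  then show "q \<in> C \<Longrightarrow> (INF q\<in>C. q x) \<le> q x" .
  show "sublinear (\<lambda>x. INF q\<in>C. q x)"
  proof (rule sublinearI)
    fix x y
    have le: "(INF q\<in>C. q (x + y)) \<le> q x + r y" if "q \<in> C" "r \<in> C" for q r
    proof -
      have "\<exists>s\<in>C. s x \<le> q x \<and> s y \<le> r y"
        using chain[OF that] that by (metis order_refl)
      then obtain s where s: "s \<in> C" "s x \<le> q x" "s y \<le> r y"
        by blast
      with C[OF s(1)] have "s (x + y) \<le> q x + r y"
        unfolding sublinear_def by (smt (verit))
      with low[OF s(1)] show ?thesis by (meson order_trans)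
    qed
    have "(INF q\<in>C. q (x + y)) - q x \<le> (INF r\<in>C. r y)" if "q \<in> C" for q
    proof (rule cINF_greatest[OF \<open>C \<noteq> {}\<close>])
      fix r assume "r \<in> C"
      from le[OF that this] show "(INF q\<in>C. q (x + y)) - q x \<le> r y"
        by simp
    qed
    then have "(INF q\<in>C. q (x + y)) - (INF r\<in>C. r y) \<le> (INF q\<in>C. q x)"
      by (intro cINF_greatest[OF \<open>C \<noteq> {}\<close>]) (simp add: algebra_simps)
    then show "(INF q\<in>C. q (x + y)) \<le> (INF q\<in>C. q x) + (INF q\<in>C. q y)" by simp
  next
    have "(\<lambda>q. q 0) ` C = {0}"
      using C sublinear_zero \<open>C \<noteq> {}\<close> by force
    then show "(INF q\<in>C. q 0) = 0" by simp
  next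
    fix c :: real and x assume "c > 0"
    have "(INF q\<in>C. q (c *\<^sub>R x)) / c \<le> q x" if "q \<in> C" for q
      using low[OF that, of "c *\<^sub>R x"] C[OF that] \<open>c > 0\<close>
      by (simp add: sublinear_def field_simps)
    then have "(INF q\<in>C. q (c *\<^sub>R x)) / c \<le> (INF q\<in>C. q x)"
      by (intro cINF_greatest[OF \<open>C \<noteq> {}\<close>])
    then show "(INF q\<in>C. q (c *\<^sub>R x)) \<le> c * (INF q\<in>C. q x)"
      using \<open>c > 0\<close> by (simp add: field_simps)
  qed
qed

text \<open>Passing from \<open>q\<close> to \<open>r\<close> decreases the value at \<open>- y\<close> to at most \<open>- q y\<close>; a minimal sublinear
  functional is therefore odd and additive.\<close>

lemma sublinear_directional:
  fixes q :: "'a::real_vector \<Rightarrow> real" and y :: 'a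
  assumes q: "sublinear q"
  defines "r \<equiv> \<lambda>x. INF t\<in>{0..}. q (x + t *\<^sub>R y) - t * q y"
  shows "sublinear r" and "t \<ge> 0 \<Longrightarrow> r x \<le> q (x + t *\<^sub>R y) - t * q y"
proof -
  have add: "\<And>x y. q (x + y) \<le> q x + q y" and scale: "\<And>c x. c \<ge> 0 \<Longrightarrow> q (c *\<^sub>R x) = c * q x"
    using q by (auto simp: sublinear_def)
  have bdd: "bdd_below ((\<lambda>t. q (x + t *\<^sub>R y) - t * q y) ` {0..})" for x
  proof (rule bdd_belowI2)
    fix t :: real assume "t \<in> {0..}"
    then show "- q (- x) \<le> q (x + t *\<^sub>R y) - t * q y"
      using add[of "x + t *\<^sub>R y" "- x"] scale[of t y] by simp
  qed
  have low: "r x \<le> q (x + t *\<^sub>R y) - t * q y" if "t \<ge> 0" for x t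
    unfolding r_def by (rule cINF_lower[OF bdd]) (use that in simp)
  then show "t \<ge> 0 \<Longrightarrow> r x \<le> q (x + t *\<^sub>R y) - t * q y" .
  have great: "a \<le> r x" if "\<And>t. t \<ge> 0 \<Longrightarrow> a \<le> q (x + t *\<^sub>R y) - t * q y" for a x
    unfolding r_def by (rule cINF_greatest) (use that in auto)
  show "sublinear r"
  proof (rule sublinearI)
    fix x z
    \<comment> \<open>The parameter \<open>t + s\<close> is admissible in the infimum at
      \<open>x + z\<close>, and its correction term splits accordingly.\<close>
    have le: "r (x + z) \<le> (q (x + t *\<^sub>R y) - t * q y) + (q (z + s *\<^sub>R y) - s * q y)"
      if "t \<ge> 0" "s \<ge> 0" for s t
      using low[of "t + s" "x + z"] add[of "x + t *\<^sub>R y" "z + s *\<^sub>R y"] that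
      by (simp add: algebra_simps)
    have "r (x + z) - (q (x + t *\<^sub>R y) - t * q y) \<le> r z" if "t \<ge> 0" for t
    proof (rule great)
      fix s :: real assume "s \<ge> 0"
      from le[OF that this] show "r (x + z) - (q (x + t *\<^sub>R y) - t * q y) \<le> q (z + s *\<^sub>R y) - s * q y"
        by simp
    qed
    then have "r (x + z) - r z \<le> r x"
      by (intro great) (simp add: algebra_simps)
    then show "r (x + z) \<le> r x + r z" by simp
  next
    show "r 0 = 0"
      unfolding r_def by (simp add: scale cong: image_cong_simp)
  next
    fix c :: real and x assume "c > 0"
    have "r (c *\<^sub>R x) / c \<le> q (x + t *\<^sub>R y) - t * q y" if "t \<ge> 0" for t
    proof -
      \<comment> \<open>Positive homogeneity comes from rescaling the parameter \<open>t\<close> to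
        \<open>c * t\<close>.\<close>
      have "r (c *\<^sub>R x) \<le> q (c *\<^sub>R (x + t *\<^sub>R y)) - c * t * q y"
        using low[of "c * t" "c *\<^sub>R x"] that \<open>c > 0\<close> by (simp add: algebra_simps)
      also have "\<dots> = c * (q (x + t *\<^sub>R y) - t * q y)"
        using scale[of c "x + t *\<^sub>R y"] \<open>c > 0\<close> by (simp add: algebra_simps)
      finally show ?thesis using \<open>c > 0\<close> by (simp add: field_simps)
    qed
    then have "r (c *\<^sub>R x) / c \<le> r x"
      by (rule great)
    then show "r (c *\<^sub>R x) \<le> c * r x"
      using \<open>c > 0\<close> by (simp add: field_simps)
  qed
qed

lemma minimal_sublinear_imp_linear:
  fixes q :: "'a::real_vector \<Rightarrow> real"
  assumes q: "sublinear q"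
    and minimal: "\<And>r. sublinear r \<Longrightarrow> (\<And>x. r x \<le> q x) \<Longrightarrow> r = q"
  shows "linear q"
proof -
  have add_le: "q (x + y) \<le> q x + q y" and scale: "c \<ge> 0 \<Longrightarrow> q (c *\<^sub>R x) = c * q x" for x y c
    using q by (auto simp: sublinear_def)
  have add: "q (x + y) = q x + q y" for x y
  proof -
    let ?r = "\<lambda>x. INF t\<in>{0..}. q (x + t *\<^sub>R y) - t * q y"
    have "?r = q"
      using sublinear_directional(1)[OF q, of y] sublinear_directional(2)[OF q, of 0 _ y]
      by (intro minimal) simp_all
    \<comment> \<open>Since \<open>?r\<close> equals \<open>q\<close>, the parameter
      \<open>t = 1\<close> in its infimum gives superadditivity.\<close>
    from fun_cong[OF this, of x] have "q x \<le> q (x + y) - q y"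
      using sublinear_directional(2)[OF q, of 1 x y] by simp
    with add_le[of x y] show ?thesis by simp
  qed
  then have neg: "q (- x) = - q x" for x
    using sublinear_zero[OF q] by (metis add.right_inverse add_eq_0_iff)
  have "q (c *\<^sub>R x) = c * q x" for c x
    using scale[of c x] scale[of "- c" x] neg[of "c *\<^sub>R x"] by (cases "c \<ge> 0") auto
  with add show ?thesis
    by (intro linearI) auto
qed

text \<open>A minimal sublinear functional below \<open>p\<close> is linear, but it need not agree
  with \<open>p\<close> at \<open>x0\<close>. Minimising below \<open>p'\<close> instead enforces
  this: \<open>p' (- x0)\<close> is at most \<open>- p x0\<close>, so a linear functional below
  \<open>p'\<close> is at least \<open>p x0\<close> at \<open>x0\<close>.\<close>

lemma hahn_banach_sublinear:
  fixes p :: "'a::real_vector \<Rightarrow> real"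
  assumes p: "sublinear p"
  obtains \<phi> where "linear \<phi>" "\<And>x. \<phi> x \<le> p x" "\<phi> x0 = p x0"
proof -
  define p' where "p' = (\<lambda>x. INF t\<in>{0..}. p (x + t *\<^sub>R x0) - t * p x0)"
  have p': "sublinear p'" "p' x \<le> p x" "p' (- x0) \<le> - p x0" for x
    using sublinear_directional(1)[OF p, of x0] sublinear_directional(2)[OF p, of 0 x x0]
      sublinear_directional(2)[OF p, of 1 "- x0" x0] sublinear_zero[OF p] by (simp_all add: p'_def)
  define A where "A = {q. sublinear q \<and> (\<forall>x. q x \<le> p' x)}"
  \<comment> \<open>The order is reversed, so that a maximal element in Zorn's lemma is a pointwise
    minimal functional.\<close>
  define P where "P = (\<lambda>q r :: 'a \<Rightarrow> real. \<forall>x. r x \<le> q x)"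
  have "\<exists>m\<in>A. \<forall>a\<in>A. P m a \<longrightarrow> a = m"
  proof (rule predicate_Zorn)
    show "partial_order_on A (relation_of P A)"
      by (rule partial_order_on_relation_ofI) (auto simp: P_def intro: order_trans intro!: ext order_antisym)
  next
    fix C assume "C \<in> Chains (relation_of P A)"
    then have C: "q \<in> A" "P q r \<or> P r q" if "q \<in> C" "r \<in> C" for q r
      using that by (auto simp: Chains_def relation_of_def)
    show "\<exists>u\<in>A. \<forall>a\<in>C. P a u"
    proof (cases "C = {}")
      case True
      then show ?thesis using p'(1) by (auto simp: A_def)
    next
      case False
      note inf = sublinear_Inf_chain[OF False, of p']
      have "sublinear (\<lambda>x. INF q\<in>C. q x)" "\<And>q x. q \<in> C \<Longrightarrow> (INF q\<in>C. q x) \<le> q x"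
        using C by (intro inf; auto simp: A_def P_def)+
      moreover from this(2) have "(INF q\<in>C. q x) \<le> p' x" for x
        using False C(1) unfolding A_def by (metis (no_types, lifting) all_not_in_conv mem_Collect_eq order_trans)
      ultimately show ?thesis
        by (auto simp: A_def P_def intro!: bexI[of _ "\<lambda>x. INF q\<in>C. q x"])
    qed
  qed
  then obtain \<phi> where \<phi>: "\<phi> \<in> A" "\<And>a. a \<in> A \<Longrightarrow> P \<phi> a \<Longrightarrow> a = \<phi>"
    by blast
  have le: "\<phi> x \<le> p' x" for x
    using \<phi>(1) by (simp add: A_def)
  have "linear \<phi>"
  proof (rule minimal_sublinear_imp_linear)
    show "r = \<phi>" if "sublinear r" "\<And>x. r x \<le> \<phi> x" for r
      using that le by (intro \<phi>(2)) (auto simp: A_def P_def intro: order_trans)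
  qed (use \<phi>(1) in \<open>simp add: A_def\<close>)
  moreover have "\<phi> x \<le> p x" for x
    using le p'(2) order_trans by blast
  moreover have "\<phi> x0 \<ge> p x0"
    using le[of "- x0"] p'(3) linear_neg[OF \<open>linear \<phi>\<close>, of x0] by simp
  ultimately show thesis
    using that by (metis order_antisym)
qed

section \<open>Gauges of convex sets and separating continuous linear functionals\<close>

lemma continuous_map_realI:
  assumes "\<And>x e. x \<in> topspace X \<Longrightarrow> e > 0 \<Longrightarrow>
    \<exists>U. openin X U \<and> x \<in> U \<and> (\<forall>y\<in>U. \<bar>f y - f x\<bar> < (e::real))"
  shows "continuous_map X euclideanreal f"
proof -
  have "openin X {x \<in> topspace X. f x \<in> S}" if "open S" for S
  proof (subst openin_subopen, safe)
    fix x assume "x \<in> topspace X" "f x \<in> S"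
    with \<open>open S\<close> obtain e where "e > 0" and e: "\<And>z. \<bar>z - f x\<bar> < e \<Longrightarrow> z \<in> S"
      by (auto simp: open_dist dist_real_def)
    with assms[OF \<open>x \<in> topspace X\<close>] obtain U where
      "openin X U" "x \<in> U" "\<forall>y\<in>U. \<bar>f y - f x\<bar> < e" by blast
    then show "\<exists>U. openin X U \<and> x \<in> U \<and> U \<subseteq> {x \<in> topspace X. f x \<in> S}"
      using e openin_subset[of X U] by (intro exI[of _ U]) blast
  qed
  then show ?thesis
    by (auto simp: continuous_map_def)
qed

text \<open>The point is the mean of the two given points with weights \<open>t / (t + s)\<close>
  and \<open>s / (t + s)\<close>. This is what makes the gauge of a convex set subadditive.\<close>

lemma convex_scaled_add:
  fixes W :: "'a::real_vector set"
  assumes "convex W" "x /\<^sub>R t \<in> W" "y /\<^sub>R s \<in> W" "t > 0" "s > 0"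
  shows "(x + y) /\<^sub>R (t + s) \<in> W"
proof -
  have "(t / (t + s)) *\<^sub>R (x /\<^sub>R t) + (s / (t + s)) *\<^sub>R (y /\<^sub>R s) \<in> W"
    using assms by (intro convexD) (auto simp: add_divide_distrib[symmetric])
  moreover have "(t / (t + s)) *\<^sub>R (x /\<^sub>R t) + (s / (t + s)) *\<^sub>R (y /\<^sub>R s) = (x + y) /\<^sub>R (t + s)"
    using assms by (simp add: algebra_simps divide_inverse flip: mult.assoc)
  ultimately show ?thesis by simp
qed

text \<open>The functional is the gauge of \<open>W\<close>, the infimum of all \<open>t > 0\<close>
  with \<open>x /\<^sub>R t\<close> in \<open>W\<close>. A value below 1 would make \<open>x\<close>
  a convex combination of some point \<open>x /\<^sub>R t\<close> of \<open>W\<close> and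
  \<open>0\<close>, hence a point of \<open>W\<close>.\<close>

lemma minkowski_functional:
  fixes W :: "'a::real_vector set"
  assumes "convex W" "0 \<in> W" and absorb: "\<And>x. \<exists>t>0. x /\<^sub>R t \<in> W"
  obtains p where "sublinear p" "\<And>x. x \<in> W \<Longrightarrow> p x \<le> 1" "\<And>x. x \<notin> W \<Longrightarrow> p x \<ge> 1"
proof -
  define S where "S = (\<lambda>x. {t. t > 0 \<and> x /\<^sub>R t \<in> W})"
  define p where "p = (\<lambda>x. Inf (S x))"
  have ne: "S x \<noteq> {}" for x
    using absorb[of x] by (auto simp: S_def)
  have low: "p x \<le> t" if "t \<in> S x" for t x
    unfolding p_def by (rule cInf_lower[OF that]) (auto simp: S_def intro: bdd_belowI[of _ 0])
  have great: "c \<le> p x" if "\<And>t. t \<in> S x \<Longrightarrow> c \<le> t" for c x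
    unfolding p_def by (rule cInf_greatest[OF ne]) (rule that)
  show thesis
  proof
    show "sublinear p"
    proof (rule sublinearI)
      fix x y
      have "p (x + y) \<le> t + s" if "t \<in> S x" "s \<in> S y" for t s
        using that convex_scaled_add[OF \<open>convex W\<close>] by (intro low) (auto simp: S_def)
      then have "p (x + y) - t \<le> p y" if "t \<in> S x" for t
        using that by (intro great) (metis diff_le_eq add.commute)
      then have "p (x + y) - p y \<le> p x"
        by (intro great) (simp add: algebra_simps)
      then show "p (x + y) \<le> p x + p y" by simp
    next
      have "0 \<le> p 0"
        by (rule great) (simp add: S_def)
      moreover have "p 0 \<le> e" if "e > 0" for e
        using that assms(2) by (intro low) (simp add: S_def)
      ultimately show "p 0 = 0"
        by (metis order_antisym field_le_epsilon add_0)
    next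
      fix c :: real and x assume "c > 0"
      have "p (c *\<^sub>R x) / c \<le> p x"
      proof (rule great)
        fix t assume "t \<in> S x"
        then have "c * t \<in> S (c *\<^sub>R x)"
          using \<open>c > 0\<close> by (simp add: S_def mult.commute flip: mult.assoc)
        from low[OF this] show "p (c *\<^sub>R x) / c \<le> t"
          using \<open>c > 0\<close> by (simp add: field_simps)
      qed
      then show "p (c *\<^sub>R x) \<le> c * p x"
        using \<open>c > 0\<close> by (simp add: field_simps)
    qed
  next
    show "p x \<le> 1" if "x \<in> W" for x
      using that by (intro low) (simp add: S_def)
  next
    fix x assume "x \<notin> W"
    show "1 \<le> p x"
    proof (rule great, rule ccontr)
      fix t assume "t \<in> S x" "\<not> 1 \<le> t"
      then have "t *\<^sub>R (x /\<^sub>R t) + (1 - t) *\<^sub>R 0 \<in> W"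
        using assms by (intro convexD) (auto simp: S_def)
      with \<open>t \<in> S x\<close> \<open>x \<notin> W\<close> show False by (simp add: S_def)
    qed
  qed
qed

text \<open>Hahn-Banach is applied to the gauge of a convex symmetric neighbourhood \<open>W\<close>
  of \<open>0\<close> that misses \<open>x - y\<close>. The functional is at least 1 at
  \<open>x - y\<close>, and it is continuous because it is bounded on \<open>W\<close>.\<close>

lemma continuous_linear_functional_separates:
  fixes T :: "'a::real_vector topology"
  assumes T: "locally_convex_linear_space T" and "x \<noteq> y"
  obtains \<phi> where "linear \<phi>" "continuous_map T euclideanreal \<phi>" "\<phi> x \<noteq> \<phi> y"
proof -
  have top: "topspace T = UNIV" and "Hausdorff_space T"
    and addc: "continuous_map (prod_topology T T) T (\<lambda>(x, y). x + y)"
    and scalec: "continuous_map (prod_topology euclideanreal T) T (\<lambda>(c, x). c *\<^sub>R x)"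
    and lc: "\<And>U. openin T U \<Longrightarrow> 0 \<in> U \<Longrightarrow> \<exists>V. openin T V \<and> convex V \<and> 0 \<in> V \<and> V \<subseteq> U"
    using T by (auto simp: locally_convex_linear_space_def)
  have aff: "continuous_map T T (\<lambda>z. c *\<^sub>R (z + a))" for c :: real and a
  proof -
    have 1: "continuous_map T T (\<lambda>z. z + a)"
      using continuous_map_compose[OF _ addc, of T "\<lambda>z. (z, a)"]
      by (simp add: continuous_map_pairwise o_def top)
    show ?thesis
      using continuous_map_compose[OF _ scalec, of T "\<lambda>z. (c, z + a)"] 1
      by (simp add: continuous_map_pairwise o_def top)
  qed
  have ray: "continuous_map euclideanreal T (\<lambda>c. c *\<^sub>R z)" for z
    using continuous_map_compose[OF _ scalec, of euclideanreal "\<lambda>c. (c, z)"]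
    by (simp add: continuous_map_pairwise o_def top)
  have pre: "openin T {z. c *\<^sub>R (z + a) \<in> U}" if "openin T U" for c :: real and a U
    using openin_continuous_map_preimage[OF aff that, of c a] by (simp add: top)
  obtain U where U: "openin T U" "0 \<in> U" "x - y \<notin> U"
    using \<open>Hausdorff_space T\<close> \<open>x \<noteq> y\<close> top unfolding Hausdorff_space_def disjnt_def
    by (metis UNIV_I disjoint_iff right_minus_eq)
  obtain V where V: "openin T V" "convex V" "0 \<in> V" "V \<subseteq> U"
    using lc[OF U(1,2)] by blast
  \<comment> \<open>Symmetry turns the one-sided bound by the gauge into a bound on
    \<open>\<bar>\<phi> z\<bar>\<close> over \<open>W\<close>.\<close>
  define W where "W = V \<inter> uminus -` V"
  have W: "openin T W" "convex W" "0 \<in> W" "x - y \<notin> W" "\<And>z. z \<in> W \<Longrightarrow> - z \<in> W"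
  proof -
    have "uminus -` V = {z. (-1) *\<^sub>R (z + 0) \<in> V}" by auto
    then show "openin T W"
      using V pre[of V "-1" 0] unfolding W_def by (metis openin_Int)
    show "convex W"
      unfolding W_def using V(2) by (intro convex_Int convex_linear_vimage)
        (auto intro: linear_uminus)
  qed (use V U in \<open>auto simp: W_def\<close>)
  have "\<exists>t>0. z /\<^sub>R t \<in> W" for z
  proof -
    have "open {c. c *\<^sub>R z \<in> W}" "0 \<in> {c. c *\<^sub>R z \<in> W}"
      using openin_continuous_map_preimage[OF ray W(1)] W(3) by simp_all
    then obtain e where "e > 0" "\<And>c. \<bar>c\<bar> < e \<Longrightarrow> c *\<^sub>R z \<in> W"
      unfolding open_dist dist_real_def by (metis diff_zero mem_Collect_eq)
    then show ?thesis
      by (intro exI[of _ "inverse (e / 2)"]) simp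
  qed
  then obtain p where p: "sublinear p" "\<And>z. z \<in> W \<Longrightarrow> p z \<le> 1" "\<And>z. z \<notin> W \<Longrightarrow> p z \<ge> 1"
    using minkowski_functional[OF W(2,3)] by metis
  obtain \<phi> where \<phi>: "linear \<phi>" "\<And>z. \<phi> z \<le> p z" "\<phi> (x - y) = p (x - y)"
    using hahn_banach_sublinear[OF p(1)] by metis
  have bound: "\<bar>\<phi> z\<bar> \<le> 1" if "z \<in> W" for z
    using \<phi>(2)[of z] \<phi>(2)[of "- z"] p(2)[OF that] p(2)[OF W(5)[OF that]] linear_neg[OF \<phi>(1), of z]
    by linarith
  show thesis
  proof
    show "continuous_map T euclideanreal \<phi>"
    proof (rule continuous_map_realI)
      fix z e assume "(e::real) > 0"
      \<comment> \<open>This is the translate of \<open>(e / 2) W\<close> to \<open>z\<close>, on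
        which \<open>\<phi>\<close> differs from \<open>\<phi> z\<close> by at most
        \<open>e / 2\<close>.\<close>
      let ?U = "{w. (2 / e) *\<^sub>R (w + - z) \<in> W}"
      have "\<bar>\<phi> w - \<phi> z\<bar> < e" if "w \<in> ?U" for w
      proof -
        have "\<bar>\<phi> ((2 / e) *\<^sub>R (w + - z))\<bar> \<le> 1"
          using that bound by blast
        moreover have "\<phi> ((2 / e) *\<^sub>R (w + - z)) = (2 / e) * (\<phi> w - \<phi> z)"
          using \<phi>(1) by (simp only: linear_scale linear_diff add_uminus_conv_diff real_scaleR_def)
        ultimately have "(2 / e) * \<bar>\<phi> w - \<phi> z\<bar> \<le> 1"
          using \<open>e > 0\<close> by (simp only: abs_mult) simp
        then have "2 * \<bar>\<phi> w - \<phi> z\<bar> \<le> e"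
          using \<open>e > 0\<close> by (simp only: times_divide_eq_left divide_le_eq if_True mult_1)
        then show ?thesis
          using \<open>e > 0\<close> by (smt (verit))
      qed
      moreover have "openin T ?U" "z \<in> ?U"
        using pre[OF W(1), of "2 / e" "- z"] W(3) by simp_all
      ultimately show "\<exists>U. openin T U \<and> z \<in> U \<and> (\<forall>y\<in>U. \<bar>\<phi> y - \<phi> z\<bar> < e)"
        by blast
    qed
    show "\<phi> x \<noteq> \<phi> y"
      using \<phi>(1,3) p(3)[OF W(4)] by (simp add: linear_diff)
  qed (rule \<phi>(1))
qed

lemma continuous_affine_functions_separate:
  assumes "convex_compactum T K" "x \<noteq> y"
  obtains g where "g \<in> continuous_affine_functions T K" "g x \<noteq> g y"
proof -
  obtain \<phi> where "linear \<phi>" "continuous_map T euclideanreal \<phi>" "\<phi> x \<noteq> \<phi> y"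
    using assms continuous_linear_functional_separates unfolding convex_compactum_def by metis
  then show thesis
    by (intro that) (auto simp: continuous_affine_functions_def linear_add linear_scale
        intro: continuous_map_from_subtopology)
qed

subsection \<open>Operations on continuous affine functions\<close>

lemma continuous_affine_functionsD:
  assumes "f \<in> continuous_affine_functions T K"
  shows "continuous_map (subtopology T K) euclideanreal f"
    and "x \<in> K \<Longrightarrow> y \<in> K \<Longrightarrow> 0 \<le> t \<Longrightarrow> t \<le> 1 \<Longrightarrow>
      f ((1 - t) *\<^sub>R x + t *\<^sub>R y) = (1 - t) * f x + t * f y"
  using assms by (auto simp: continuous_affine_functions_def)

lemma continuous_affine_functions_add:
  assumes "f \<in> continuous_affine_functions T K" "g \<in> continuous_affine_functions T K"
  shows "(\<lambda>x. f x + g x) \<in> continuous_affine_functions T K"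
  using assms by (auto simp: continuous_affine_functions_def continuous_map_add ring_distribs)

lemma continuous_affine_functions_mult:
  assumes "f \<in> continuous_affine_functions T K"
  shows "(\<lambda>x. c * f x) \<in> continuous_affine_functions T K"
  using assms by (auto simp: continuous_affine_functions_def continuous_map_real_mult_left ring_distribs)

lemma continuous_affine_functions_diff:
  assumes "f \<in> continuous_affine_functions T K" "g \<in> continuous_affine_functions T K"
  shows "(\<lambda>x. f x - g x) \<in> continuous_affine_functions T K"
  using assms by (auto simp: continuous_affine_functions_def continuous_map_diff ring_distribs)

lemma continuous_affine_functions_sum:
  assumes "\<And>i. i \<in> I \<Longrightarrow> f i \<in> continuous_affine_functions T K"
  shows "(\<lambda>x. \<Sum>i\<in>I. f i x) \<in> continuous_affine_functions T K"
  using assms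
proof (induction I rule: infinite_finite_induct)
  case (insert i I)
  then show ?case
    using continuous_affine_functions_add[of "f i" T K "\<lambda>x. \<Sum>i\<in>I. f i x"] by simp
qed (simp_all add: continuous_affine_functions_def)

section \<open>Uniform limits and infinite convex combinations with weights
  \<open>1 / 2 ^ Suc k\<close>\<close>

lemma continuous_map_real_uniform_limit:
  fixes f :: "nat \<Rightarrow> 'a \<Rightarrow> real"
  assumes "\<And>n. continuous_map X euclideanreal (f n)"
    and "\<And>e. e > 0 \<Longrightarrow> \<exists>n. \<forall>x\<in>topspace X. \<bar>f n x - g x\<bar> < e"
  shows "continuous_map X euclideanreal g"
proof (rule continuous_map_realI)
  fix x e assume x: "x \<in> topspace X" and "(e::real) > 0"
  then obtain n where n: "\<forall>x\<in>topspace X. \<bar>f n x - g x\<bar> < e / 3"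
    using assms(2)[of "e / 3"] by auto
  let ?U = "{y \<in> topspace X. f n y \<in> ball (f n x) (e / 3)}"
  have "openin X ?U"
    using assms(1)[of n] by (intro openin_continuous_map_preimage) auto
  moreover have "\<bar>g y - g x\<bar> < e" if "y \<in> ?U" for y
  proof -
    have "\<bar>f n x - f n y\<bar> < e / 3" "\<bar>f n y - g y\<bar> < e / 3" "\<bar>f n x - g x\<bar> < e / 3"
      using that n x by (auto simp: dist_real_def)
    then show ?thesis by linarith
  qed
  ultimately show "\<exists>U. openin X U \<and> x \<in> U \<and> (\<forall>y\<in>U. \<bar>g y - g x\<bar> < e)"
    using x \<open>e > 0\<close> by (intro exI[of _ ?U]) auto
qed

lemma summable_dominated_powers_of_half:
  fixes a :: "nat \<Rightarrow> real"
  assumes "\<And>k. \<bar>a k\<bar> \<le> M"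
  shows "summable (\<lambda>k. a k / 2 ^ k)"
proof (rule summable_comparison_test')
  show "summable (\<lambda>k. M * (1 / 2) ^ k :: real)"
    by (intro summable_mult) simp
  show "norm (a k / 2 ^ k) \<le> M * (1 / 2) ^ k" for k
    using assms[of k] by (simp add: field_simps power_one_over)
qed

text \<open>The weights \<open>1 / 2 ^ Suc k\<close> sum to 1, so the series is an infinite convex
  combination and inherits constant bounds from its terms.\<close>

lemma suminf_powers_of_half_bounds:
  fixes a :: "nat \<Rightarrow> real"
  assumes "\<And>k. \<bar>a k\<bar> \<le> M"
  shows "(\<And>k. a k \<le> c) \<Longrightarrow> (\<Sum>k. a k / 2 ^ Suc k) \<le> c"
    and "(\<And>k. c \<le> a k) \<Longrightarrow> c \<le> (\<Sum>k. a k / 2 ^ Suc k)"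
    and "summable (\<lambda>k. a k / 2 ^ Suc k)"
proof -
  show s: "summable (\<lambda>k. a k / 2 ^ Suc k)"
    using summable_mult[OF summable_dominated_powers_of_half[OF assms], of "1/2"] by simp
  have c: "(\<lambda>k. c * (1 / 2) ^ Suc k) sums (c * 1)" for c :: real
    by (intro sums_mult power_half_series)
  show "(\<Sum>k. a k / 2 ^ Suc k) \<le> c" if "\<And>k. a k \<le> c" for c
  proof -
    have "(\<Sum>k. a k / 2 ^ Suc k) \<le> (\<Sum>k. c * (1 / 2) ^ Suc k)"
      using that by (intro suminf_le s sums_summable[OF c])
        (simp add: field_simps power_one_over)
    then show ?thesis using sums_unique[OF c[of c]] by simp
  qed
  show "c \<le> (\<Sum>k. a k / 2 ^ Suc k)" if "\<And>k. c \<le> a k" for c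
  proof -
    have "(\<Sum>k. c * (1 / 2) ^ Suc k) \<le> (\<Sum>k. a k / 2 ^ Suc k)"
      using that by (intro suminf_le s sums_summable[OF c])
        (simp add: field_simps power_one_over)
    then show ?thesis using sums_unique[OF c[of c]] by simp
  qed
qed

text \<open>By the Weierstrass test the uniform bound \<open>M\<close> makes the partial sums
  converge uniformly on \<open>K\<close>, which gives continuity. Affinity passes through the sum
  termwise.\<close>

lemma continuous_affine_functions_suminf:
  assumes "\<And>k. g k \<in> continuous_affine_functions T K"
    and bound: "\<And>k x. x \<in> K \<Longrightarrow> \<bar>g k x\<bar> \<le> M" and "convex K"
  shows "(\<lambda>x. \<Sum>k. g k x / 2 ^ Suc k) \<in> continuous_affine_functions T K"
proof -
  have s: "summable (\<lambda>k. g k x / 2 ^ Suc k)" if "x \<in> K" for x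
    using suminf_powers_of_half_bounds(3)[of "\<lambda>k. g k x" M] bound[OF that] by simp
  have "continuous_map (subtopology T K) euclideanreal (\<lambda>x. \<Sum>k. g k x / 2 ^ Suc k)"
  proof (rule continuous_map_real_uniform_limit)
    show "continuous_map (subtopology T K) euclideanreal (\<lambda>x. \<Sum>k<n. (1 / 2 ^ Suc k) * g k x)" for n
      by (intro continuous_affine_functionsD(1) continuous_affine_functions_sum
          continuous_affine_functions_mult assms)
  next
    fix e :: real assume "e > 0"
    have M: "summable (\<lambda>k. M * (1 / 2) ^ Suc k :: real)"
      by (intro summable_mult sums_summable[OF power_half_series])
    have "uniform_limit K (\<lambda>n x. \<Sum>k<n. g k x / 2 ^ Suc k) (\<lambda>x. \<Sum>k. g k x / 2 ^ Suc k) sequentially"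
      by (rule Weierstrass_m_test[OF _ M])
        (use bound in \<open>simp add: field_simps power_one_over\<close>)
    from uniform_limitD[OF this \<open>e > 0\<close>]
    obtain n where "\<forall>x\<in>K. dist (\<Sum>k<n. g k x / 2 ^ Suc k) (\<Sum>k. g k x / 2 ^ Suc k) < e"
      by (auto simp: eventually_sequentially)
    then show "\<exists>n. \<forall>x\<in>topspace (subtopology T K).
        \<bar>(\<Sum>k<n. (1 / 2 ^ Suc k) * g k x) - (\<Sum>k. g k x / 2 ^ Suc k)\<bar> < e"
      by (auto simp: dist_real_def)
  qed
  moreover have "(\<Sum>k. g k ((1 - t) *\<^sub>R x + t *\<^sub>R y) / 2 ^ Suc k) =
      (1 - t) * (\<Sum>k. g k x / 2 ^ Suc k) + t * (\<Sum>k. g k y / 2 ^ Suc k)"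
    if "x \<in> K" "y \<in> K" "0 \<le> t" "t \<le> 1" for x y t
  proof -
    have "(\<lambda>k. (1 - t) * (g k x / 2 ^ Suc k) + t * (g k y / 2 ^ Suc k)) sums
        ((1 - t) * (\<Sum>k. g k x / 2 ^ Suc k) + t * (\<Sum>k. g k y / 2 ^ Suc k))"
      using that by (intro sums_add sums_mult summable_sums s)
    moreover have "(1 - t) * (g k x / 2 ^ Suc k) + t * (g k y / 2 ^ Suc k) =
        g k ((1 - t) *\<^sub>R x + t *\<^sub>R y) / 2 ^ Suc k" for k
      using that by (simp add: continuous_affine_functionsD(2)[OF assms(1)] add_divide_distrib)
    ultimately show ?thesis
      by (simp add: sums_iff)
  qed
  ultimately show ?thesis
    by (simp add: continuous_affine_functions_def)
qed

subsection \<open>Simons' theorem for boundaries\<close>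

text \<open>A limit function \<open>H\<close> is built from infinite convex combinations so that, at
  a point \<open>b\<close> of \<open>B\<close> where \<open>H\<close> is maximal, all its rescaled
  tails exceed a fixed \<open>\<delta> > 0\<close>. Each tail is dominated at \<open>b\<close> by
  the corresponding late values of \<open>f\<close>, which tend to 0.\<close>

lemma simons_lemma:
  assumes "convex K" and bd: "boundary_of T K B"
    and f: "\<And>n. f n \<in> continuous_affine_functions T K"
    and M: "\<And>n x. x \<in> K \<Longrightarrow> \<bar>f n x\<bar> \<le> M"
    and x0: "x0 \<in> K" "\<eta> > 0" "\<And>n. \<eta> \<le> f n x0"
    and lim: "\<And>b. b \<in> B \<Longrightarrow> (\<lambda>n. f n b) \<longlonglongrightarrow> 0"
  shows False
proof -
  define \<A> where "\<A> = continuous_affine_functions T K"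
  \<comment> \<open>The last condition says that \<open>g\<close> lies below the supremum of the
    \<open>f k\<close> with \<open>k \<ge> n\<close>. Together, the conditions are stable under
    infinite convex combinations.\<close>
  define C where "C = (\<lambda>n. {g \<in> \<A>. (\<forall>x\<in>K. \<bar>g x\<bar> \<le> M) \<and> \<eta> \<le> g x0 \<and>
    (\<forall>x\<in>K. \<forall>c. (\<forall>k\<ge>n. f k x \<le> c) \<longrightarrow> g x \<le> c)})"
  define S where "S = (\<lambda>u :: 'a \<Rightarrow> real. SUP x\<in>K. u x)"
  define \<delta> where "\<delta> = \<eta> / 3"
  have "\<delta> > 0" using x0 by (simp add: \<delta>_def)
  have CA: "g \<in> \<A>" if "g \<in> C n" for g n
    using that by (simp add: C_def)
  have fC: "f n \<in> C n" for n
    using f M x0 by (auto simp: C_def \<A>_def)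
  have S_upper: "u x \<le> S u" if "u \<in> \<A>" "x \<in> K" for u x
  proof -
    obtain b where "\<forall>x\<in>K. u x \<le> u b"
      using bd \<open>u \<in> \<A>\<close> by (auto simp: boundary_of_def \<A>_def)
    then show ?thesis
      unfolding S_def using \<open>x \<in> K\<close> by (intro cSUP_upper bdd_aboveI2) auto
  qed
  have S_eq: "S u = u b" if "b \<in> K" "\<And>x. x \<in> K \<Longrightarrow> u x \<le> u b" for u b
    unfolding S_def using that by (intro cSup_eq_maximum) auto
  have comb: "(\<lambda>x. 2 ^ n * u x + g x) \<in> \<A>" if "u \<in> \<A>" "g \<in> \<A>" for u g and n :: nat
    using that unfolding \<A>_def
    by (intro continuous_affine_functions_add continuous_affine_functions_mult)
  have tail: "(\<lambda>x. \<Sum>j. g (n + j) x / 2 ^ Suc j) \<in> C n" if g: "\<And>k. g k \<in> C k" for g n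
  proof -
    have b: "\<bar>g k x\<bar> \<le> M" if "x \<in> K" for k x
      using g[of k] that by (simp add: C_def)
    have "(\<lambda>x. \<Sum>j. g (n + j) x / 2 ^ Suc j) \<in> \<A>"
      using b CA[OF g] \<open>convex K\<close> unfolding \<A>_def by (intro continuous_affine_functions_suminf) auto
    moreover have "\<bar>\<Sum>j. g (n + j) x / 2 ^ Suc j\<bar> \<le> M" if "x \<in> K" for x
    proof (rule abs_leI)
      note bb = suminf_powers_of_half_bounds[of "\<lambda>j. g (n + j) x" M, OF b[OF that]]
      show "(\<Sum>j. g (n + j) x / 2 ^ Suc j) \<le> M"
        using b[OF that] by (intro bb(1)) (simp add: abs_le_iff)
      have "- M \<le> (\<Sum>j. g (n + j) x / 2 ^ Suc j)"
        using b[OF that] by (intro bb(2)) (simp add: abs_le_iff minus_le_iff)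
      then show "- (\<Sum>j. g (n + j) x / 2 ^ Suc j) \<le> M" by simp
    qed
    moreover have "\<eta> \<le> (\<Sum>j. g (n + j) x0 / 2 ^ Suc j)"
      by (rule suminf_powers_of_half_bounds(2)[of _ M]) (use b x0(1) g in \<open>auto simp: C_def\<close>)
    moreover have "(\<Sum>j. g (n + j) x / 2 ^ Suc j) \<le> c" if "x \<in> K" "\<forall>k\<ge>n. f k x \<le> c" for x c
    proof (rule suminf_powers_of_half_bounds(1)[of _ M])
      show "\<bar>g (n + j) x\<bar> \<le> M" for j using b that by blast
      show "g (n + j) x \<le> c" for j
        using g[of "n + j"] that by (auto simp: C_def)
    qed
    ultimately show ?thesis
      unfolding C_def by blast
  qed
  \<comment> \<open>Greedy choice: \<open>g n\<close> almost minimises \<open>S (2 ^ n * h n + g)\<close> over \<open>C n\<close>. Comparison with the tail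
    \<open>r n = 2 ^ n * (H - h n)\<close>, which lies in \<open>C n\<close>, then keeps the tails large at a maximum point of
    the limit \<open>H\<close> of the \<open>h n\<close>.\<close>
  have near_min: "\<exists>g\<in>C n. \<forall>g'\<in>C n. S (\<lambda>x. 2 ^ n * u x + g x) \<le> S (\<lambda>x. 2 ^ n * u x + g' x) + \<delta> / 2 ^ n"
    if "u \<in> \<A>" for u n
  proof -
    define R where "R = (\<lambda>g. S (\<lambda>x. 2 ^ n * u x + g x)) ` C n"
    have "R \<noteq> {}" using fC by (auto simp: R_def)
    \<comment> \<open>Evaluation at \<open>x0\<close> bounds all these suprema below, because
      members of \<open>C n\<close> are at least \<open>\<eta>\<close> there.\<close>
    have "bdd_below R"
    proof (rule bdd_belowI)
      fix r assume "r \<in> R"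
      then obtain g where "g \<in> C n" "r = S (\<lambda>x. 2 ^ n * u x + g x)" by (auto simp: R_def)
      then show "2 ^ n * u x0 + \<eta> \<le> r"
        using S_upper[OF comb[OF that CA] x0(1), of g n n] by (simp add: C_def)
    qed
    have "Inf R < Inf R + \<delta> / 2 ^ n" using \<open>\<delta> > 0\<close> by simp
    from cInf_lessD[OF \<open>R \<noteq> {}\<close> this] obtain r where r: "r \<in> R" "r < Inf R + \<delta> / 2 ^ n" by blast
    have "r \<le> r' + \<delta> / 2 ^ n" if "r' \<in> R" for r'
      using cInf_lower[OF that \<open>bdd_below R\<close>] r(2) by simp
    with r(1) show ?thesis by (auto simp: R_def)
  qed
  \<comment> \<open>The clause for \<open>n = 0\<close> carries the initial value of
    \<open>h\<close> through the dependent choice.\<close>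
  have "\<exists>h. \<forall>n. (h n \<in> \<A> \<and> (n = 0 \<longrightarrow> h n = (\<lambda>_. 0))) \<and> (\<exists>g\<in>C n. h (Suc n) = (\<lambda>x. h n x + g x / 2 ^ Suc n) \<and>
    (\<forall>g'\<in>C n. S (\<lambda>x. 2 ^ n * h n x + g x) \<le> S (\<lambda>x. 2 ^ n * h n x + g' x) + \<delta> / 2 ^ n))"
  proof (rule dependent_nat_choice)
    show "\<exists>u. u \<in> \<A> \<and> (0 = (0::nat) \<longrightarrow> u = (\<lambda>_. 0))"
      by (auto simp: \<A>_def continuous_affine_functions_def)
  next
    fix u and n :: nat assume "u \<in> \<A> \<and> (n = 0 \<longrightarrow> u = (\<lambda>_. 0))"
    then have "u \<in> \<A>" by simp
    from near_min[OF this, of n] obtain g where g: "g \<in> C n"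
      "\<forall>g'\<in>C n. S (\<lambda>x. 2 ^ n * u x + g x) \<le> S (\<lambda>x. 2 ^ n * u x + g' x) + \<delta> / 2 ^ n" by blast
    have "(\<lambda>x. u x + (1 / 2 ^ Suc n) * g x) \<in> \<A>"
      using \<open>u \<in> \<A>\<close> CA[OF g(1)] unfolding \<A>_def
      by (intro continuous_affine_functions_add continuous_affine_functions_mult)
    with g show "\<exists>v. (v \<in> \<A> \<and> (Suc n = 0 \<longrightarrow> v = (\<lambda>_. 0))) \<and> (\<exists>g\<in>C n. v = (\<lambda>x. u x + g x / 2 ^ Suc n) \<and>
        (\<forall>g'\<in>C n. S (\<lambda>x. 2 ^ n * u x + g x) \<le> S (\<lambda>x. 2 ^ n * u x + g' x) + \<delta> / 2 ^ n))"
      by (intro exI[of _ "\<lambda>x. u x + g x / 2 ^ Suc n"]) auto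
  qed
  then obtain h where hA: "\<And>n. h n \<in> \<A>" and h0: "h 0 = (\<lambda>_. 0)"
    and "\<forall>n. \<exists>g. g \<in> C n \<and> h (Suc n) = (\<lambda>x. h n x + g x / 2 ^ Suc n) \<and>
      (\<forall>g'\<in>C n. S (\<lambda>x. 2 ^ n * h n x + g x) \<le> S (\<lambda>x. 2 ^ n * h n x + g' x) + \<delta> / 2 ^ n)"
    unfolding Bex_def by auto
  from choice[OF this(3)] obtain g where g: "\<And>n. g n \<in> C n"
    and hSuc: "\<And>n. h (Suc n) = (\<lambda>x. h n x + g n x / 2 ^ Suc n)"
    and opt: "\<And>n g'. g' \<in> C n \<Longrightarrow>
      S (\<lambda>x. 2 ^ n * h n x + g n x) \<le> S (\<lambda>x. 2 ^ n * h n x + g' x) + \<delta> / 2 ^ n"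
    by blast
  have h: "h n x = (\<Sum>k<n. g k x / 2 ^ Suc k)" for n x
    by (induction n) (simp_all add: h0 hSuc)
  define H where "H = (\<lambda>x. \<Sum>k. g k x / 2 ^ Suc k)"
  define r where "r = (\<lambda>n x. \<Sum>j. g (n + j) x / 2 ^ Suc j)"
  have "H \<in> C 0" using tail[OF g, of 0] by (simp add: H_def)
  have rC: "r n \<in> C n" for n using tail[OF g, of n] by (simp add: r_def)
  \<comment> \<open>The factor \<open>2 ^ n\<close> normalises the remainder of the series: its
    weights become \<open>1 / 2 ^ Suc j\<close> again.\<close>
  have split: "2 ^ n * H x = 2 ^ n * h n x + r n x" if "x \<in> K" for n x
  proof -
    have "\<bar>g k x\<bar> \<le> M" for k
      using g[of k] that by (simp add: C_def)
    from suminf_powers_of_half_bounds(3)[of "\<lambda>k. g k x", OF this]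
    have s: "summable (\<lambda>k. g k x / 2 ^ Suc k)" .
    have "H x = h n x + (\<Sum>j. g (j + n) x / 2 ^ Suc (j + n))"
      unfolding H_def h using suminf_split_initial_segment[OF s, of n] by simp
    moreover have "r n x = 2 ^ n * (\<Sum>j. g (j + n) x / 2 ^ Suc (j + n))"
    proof -
      have "r n x = (\<Sum>j. 2 ^ n * (g (j + n) x / 2 ^ Suc (j + n)))"
        unfolding r_def by (intro suminf_cong) (simp add: power_add add.commute[of n])
      also have "\<dots> = 2 ^ n * (\<Sum>j. g (j + n) x / 2 ^ Suc (j + n))"
        by (rule suminf_mult[OF summable_ignore_initial_segment[OF s]])
      finally show ?thesis .
    qed
    ultimately show ?thesis by (simp add: distrib_left)
  qed
  obtain b where b: "b \<in> B" "\<And>x. x \<in> K \<Longrightarrow> H x \<le> H b"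
    using bd CA[OF \<open>H \<in> C 0\<close>] by (auto simp: boundary_of_def \<A>_def)
  then have "b \<in> K" using bd by (auto simp: boundary_of_def)
  have "H b \<ge> \<eta>"
    using b(2)[OF x0(1)] \<open>H \<in> C 0\<close> by (simp add: C_def)
  have step: "2 ^ n * h n b + g n b \<le> 2 ^ n * H b + \<delta> / 2 ^ n" for n
  proof -
    have "2 ^ n * h n b + g n b \<le> S (\<lambda>x. 2 ^ n * h n x + g n x)"
      using S_upper[OF comb[OF hA CA[OF g]] \<open>b \<in> K\<close>] .
    also have "\<dots> \<le> S (\<lambda>x. 2 ^ n * h n x + r n x) + \<delta> / 2 ^ n"
      by (rule opt[OF rC])
    \<comment> \<open>By \<open>split\<close> the function under \<open>S\<close> is
      \<open>2 ^ n * H\<close> on \<open>K\<close>, and this is maximal at \<open>b\<close>.\<close>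
    also have "S (\<lambda>x. 2 ^ n * h n x + r n x) = 2 ^ n * h n b + r n b"
      by (rule S_eq[OF \<open>b \<in> K\<close>]) (simp add: split[symmetric] \<open>b \<in> K\<close> b(2))
    finally show ?thesis by (simp add: split[OF \<open>b \<in> K\<close>])
  qed
  \<comment> \<open>Doubling at each step accumulates the coefficient \<open>2 ^ m - 1\<close> of
    \<open>H b\<close>, while the errors remain below \<open>2 * \<delta>\<close>. The subtracted
    term \<open>2 * \<delta> / 2 ^ m\<close> makes the induction close exactly.\<close>
  have ub: "2 ^ m * h m b \<le> (2 ^ m - 1) * H b + 2 * \<delta> - 2 * \<delta> / 2 ^ m" for m
  proof (induction m)
    case (Suc m)
    have "2 ^ Suc m * h (Suc m) b = 2 ^ m * h m b + (2 ^ m * h m b + g m b)"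
      by (simp add: hSuc field_simps)
    also have "\<dots> \<le> ((2 ^ m - 1) * H b + 2 * \<delta> - 2 * \<delta> / 2 ^ m) + (2 ^ m * H b + \<delta> / 2 ^ m)"
      by (intro add_mono Suc step)
    also have "\<dots> = (2 ^ Suc m - 1) * H b + 2 * \<delta> - 2 * \<delta> / 2 ^ Suc m"
      by (simp add: field_simps)
    finally show ?case .
  qed (simp add: h0)
  \<comment> \<open>Subtracting \<open>ub\<close> from \<open>split\<close> leaves more than
    \<open>H b - 2 * \<delta>\<close>, and \<open>H b\<close> is at least
    \<open>\<eta> = 3 * \<delta>\<close>. This explains the choice of
    \<open>\<delta>\<close>.\<close>
  have large: "r m b > \<delta>" for m
  proof -
    have "2 * \<delta> / 2 ^ m > 0" "\<eta> = 3 * \<delta>"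
      using \<open>\<delta> > 0\<close> by (simp_all add: \<delta>_def)
    moreover have "2 ^ m * h m b \<le> 2 ^ m * H b - H b + 2 * \<delta> - 2 * \<delta> / 2 ^ m"
      using ub[of m] by (simp add: left_diff_distrib)
    ultimately show ?thesis
      using split[OF \<open>b \<in> K\<close>, of m] \<open>H b \<ge> \<eta>\<close> by linarith
  qed
  obtain m where "\<And>k. k \<ge> m \<Longrightarrow> f k b < \<delta>"
    using order_tendstoD(2)[OF lim[OF b(1)] \<open>\<delta> > 0\<close>] by (auto simp: eventually_sequentially)
  then have "r m b \<le> \<delta>"
    using rC[of m] \<open>b \<in> K\<close> by (auto simp: C_def less_imp_le)
  with large[of m] show False by simp
qed

text \<open>If convergence failed at \<open>x\<close>, infinitely many differences
  \<open>d n - g\<close> would stay away from 0 there with one sign \<open>c\<close>. The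
  subsequence of these differences, multiplied by \<open>c\<close>, contradicts
  \<open>simons_lemma\<close>.\<close>

lemma boundary_pointwise_convergence:
  assumes "convex K" and bd: "boundary_of T K B"
    and d: "\<And>n. d n \<in> continuous_affine_functions T K"
    and g: "g \<in> continuous_affine_functions T K"
    and M: "\<And>n x. x \<in> K \<Longrightarrow> \<bar>d n x\<bar> \<le> M" "\<And>x. x \<in> K \<Longrightarrow> \<bar>g x\<bar> \<le> M"
    and lim: "\<And>b. b \<in> B \<Longrightarrow> (\<lambda>n. d n b) \<longlonglongrightarrow> g b"
    and "x \<in> K"
  shows "(\<lambda>n. d n x) \<longlonglongrightarrow> g x"
proof (rule LIMSEQ_I, rule ccontr)
  have fin: "finite {n. e \<le> c * (d n x - g x)}" if "\<bar>c\<bar> = 1" "e > 0" for c e :: real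
  proof (rule ccontr)
    assume "infinite {n. e \<le> c * (d n x - g x)}"
    then obtain s :: "nat \<Rightarrow> nat" where s: "strict_mono s" "\<And>n. e \<le> c * (d (s n) x - g x)"
      by (metis (no_types, lifting) infinite_enumerate mem_Collect_eq)
    show False
    proof (rule simons_lemma[OF assms(1,2), of "\<lambda>n z. c * (d (s n) z - g z)" "2 * M" x e])
      show "(\<lambda>z. c * (d (s n) z - g z)) \<in> continuous_affine_functions T K" for n
        by (intro continuous_affine_functions_mult continuous_affine_functions_diff d g)
      show "\<bar>c * (d (s n) z - g z)\<bar> \<le> 2 * M" if "z \<in> K" for n z
        using M(1)[OF that, of "s n"] M(2)[OF that] \<open>\<bar>c\<bar> = 1\<close> by (simp add: abs_mult)
      show "(\<lambda>n. c * (d (s n) b - g b)) \<longlonglongrightarrow> 0" if "b \<in> B" for b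
        using LIMSEQ_subseq_LIMSEQ[OF lim[OF that] s(1)]
        by (intro tendsto_mult_right_zero) (simp add: o_def LIM_zero)
    qed (use s \<open>x \<in> K\<close> \<open>e > 0\<close> in auto)
  qed
  fix e :: real assume "e > 0" and "\<not> (\<exists>N. \<forall>n\<ge>N. norm (d n x - g x) < e)"
  have "finite ({n. e \<le> 1 * (d n x - g x)} \<union> {n. e \<le> - 1 * (d n x - g x)})"
    using \<open>e > 0\<close> by (intro finite_UnI fin) auto
  then obtain N where N: "\<forall>n \<in> {n. e \<le> 1 * (d n x - g x)} \<union> {n. e \<le> - 1 * (d n x - g x)}. n < N"
    using finite_nat_set_iff_bounded by blast
  have "norm (d n x - g x) < e" if "n \<ge> N" for n
  proof (rule ccontr)
    assume "\<not> norm (d n x - g x) < e"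
    then have "e \<le> d n x - g x \<or> e \<le> - (d n x - g x)"
      by (auto simp: abs_if split: if_splits)
    then have "e \<le> 1 * (d n x - g x) \<or> e \<le> - 1 * (d n x - g x)"
      by simp
    with N that show False
      by (simp only: Un_iff mem_Collect_eq ball_simps Ball_def) (meson leD)
  qed
  with \<open>\<not> _\<close> show False by blast
qed

subsection \<open>Cardinal bounds\<close>

lemma countable_ordLeq_Cinfinite: "Cinfinite \<kappa> \<Longrightarrow> countable A \<Longrightarrow> |A| \<le>o \<kappa>"
  by (rule ordLeq_transitive[OF iffD1[OF countable_card_le_natLeq] natLeq_ordLeq_cinfinite])

lemma card_of_image_ordLeq: "|A| \<le>o \<kappa> \<Longrightarrow> |f ` A| \<le>o \<kappa>"
  by (rule ordLeq_transitive[OF card_of_image])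

lemma card_of_Times_ordLeq_Cinfinite:
  "Cinfinite \<kappa> \<Longrightarrow> |A| \<le>o \<kappa> \<Longrightarrow> |B| \<le>o \<kappa> \<Longrightarrow> |A \<times> B| \<le>o \<kappa>"
  by (rule card_of_Sigma_ordLeq_infinite_Field) (simp_all add: cinfinite_def)

lemma card_of_UN_ordLeq_Cinfinite:
  "Cinfinite \<kappa> \<Longrightarrow> |I| \<le>o \<kappa> \<Longrightarrow> (\<And>i. i \<in> I \<Longrightarrow> |A i| \<le>o \<kappa>) \<Longrightarrow> |\<Union>i\<in>I. A i| \<le>o \<kappa>"
  by (rule card_of_UNION_ordLeq_infinite_Field) (simp_all add: cinfinite_def)

text \<open>Finite subsets are images of lists, and the lists of each fixed length are counted by
  induction, one factor \<open>A\<close> at a time.\<close>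

lemma card_of_Fpow_ordLeq_Cinfinite:
  assumes "Cinfinite \<kappa>" "|A| \<le>o \<kappa>"
  shows "|Fpow A| \<le>o \<kappa>"
proof -
  define L where "L = (\<lambda>n. {xs. set xs \<subseteq> A \<and> length xs = n})"
  have "|L n| \<le>o \<kappa>" for n
  proof (induction n)
    case 0
    have "L 0 = {[]}" by (auto simp: L_def)
    then show ?case
      using countable_ordLeq_Cinfinite[OF assms(1), of "{[]}"] by simp
  next
    case (Suc n)
    have "L (Suc n) = (\<lambda>(a, xs). a # xs) ` (A \<times> L n)"
      by (auto simp: L_def length_Suc_conv image_iff)
    then show ?case
      using Suc assms by (simp add: card_of_image_ordLeq card_of_Times_ordLeq_Cinfinite)
  qed
  then have "|\<Union>n. L n| \<le>o \<kappa>"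
    by (intro card_of_UN_ordLeq_Cinfinite assms(1) countable_ordLeq_Cinfinite[OF _ countableI_type])
  then have "|set ` (\<Union>n. L n)| \<le>o \<kappa>"
    by (rule card_of_image_ordLeq)
  moreover have "Fpow A \<subseteq> set ` (\<Union>n. L n)"
  proof
    fix F assume "F \<in> Fpow A"
    then obtain xs where "set xs = F" "F \<subseteq> A"
      using finite_list by (auto simp: Fpow_def)
    then show "F \<in> set ` (\<Union>n. L n)"
      by (intro image_eqI[of _ _ xs]) (auto simp: L_def)
  qed
  ultimately show ?thesis
    by (rule ordLeq_transitive[OF card_of_mono1, rotated])
qed

subsection \<open>Families of open sets separating points\<close>

text \<open>Both disjoint neighbourhoods come from the same family. This notion is used twice: for
  compact pieces of \<open>B\<close> and for \<open>K\<close> itself.\<close>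

definition separating_opens :: "'a topology \<Rightarrow> 'a set set \<Rightarrow> bool" where
  "separating_opens X \<P> \<longleftrightarrow> (\<forall>P\<in>\<P>. openin X P) \<and>
     (\<forall>x\<in>topspace X. \<forall>y\<in>topspace X. x \<noteq> y \<longrightarrow> (\<exists>P\<in>\<P>. \<exists>Q\<in>\<P>. x \<in> P \<and> y \<in> Q \<and> P \<inter> Q = {}))"

lemma openin_finite_Int:
  assumes "finite F" "\<And>P. P \<in> F \<Longrightarrow> openin X P"
  shows "openin X (topspace X \<inter> \<Inter>F)"
  using assms by (induction F) (auto simp: Int_left_commute)

text \<open>The points of \<open>C - G\<close> are separated from \<open>c\<close> one by one, and
  compactness reduces this to finitely many pairs. Recording \<open>V\<close> makes the result
  usable beyond \<open>C\<close>: inside any set contained in \<open>V \<union> G\<close>, the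
  intersection of \<open>F\<close> lies in \<open>G\<close>.\<close>

lemma separate_point_from_compact_part:
  assumes \<P>: "separating_opens X \<P>" and C: "compactin X C" and G: "openin X G"
    and c: "c \<in> C" "c \<in> G"
  obtains F V where "F \<in> Fpow \<P>" "c \<in> \<Inter>F" "openin X V" "C \<subseteq> V \<union> G" "\<Inter>F \<inter> V = {}"
proof -
  have "C \<subseteq> topspace X" using C compactin_subset_topspace by blast
  have "\<forall>y\<in>C - G. \<exists>P Q. P \<in> \<P> \<and> Q \<in> \<P> \<and> c \<in> P \<and> y \<in> Q \<and> P \<inter> Q = {}"
  proof
    fix y assume "y \<in> C - G"
    then have "c \<in> topspace X" "y \<in> topspace X" "c \<noteq> y"
      using c \<open>C \<subseteq> topspace X\<close> by auto
    then show "\<exists>P Q. P \<in> \<P> \<and> Q \<in> \<P> \<and> c \<in> P \<and> y \<in> Q \<and> P \<inter> Q = {}"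
      using \<P> unfolding separating_opens_def by blast
  qed
  then obtain P Q where PQ: "\<And>y. y \<in> C - G \<Longrightarrow>
      P y \<in> \<P> \<and> Q y \<in> \<P> \<and> c \<in> P y \<and> y \<in> Q y \<and> P y \<inter> Q y = {}"
    by metis
  have "C - G = (topspace X - G) \<inter> C"
    using \<open>C \<subseteq> topspace X\<close> by blast
  then have "compactin X (C - G)"
    using closed_Int_compactin[OF _ C] G by (metis closedin_diff closedin_topspace)
  moreover have "\<forall>U\<in>Q ` (C - G). openin X U" "C - G \<subseteq> \<Union> (Q ` (C - G))"
    using PQ \<P> by (auto simp: separating_opens_def)
  ultimately obtain \<F> where "finite \<F>" "\<F> \<subseteq> Q ` (C - G)" "C - G \<subseteq> \<Union>\<F>"
    unfolding compactin_def by meson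
  then obtain Y where Y: "finite Y" "Y \<subseteq> C - G" "C - G \<subseteq> \<Union> (Q ` Y)"
    by (metis finite_subset_image)
  show thesis
  proof
    show "P ` Y \<in> Fpow \<P>" "c \<in> \<Inter> (P ` Y)"
      using Y PQ by (auto simp: Fpow_def)
    show "openin X (\<Union> (Q ` Y))"
    proof (rule openin_Union)
      show "openin X U" if "U \<in> Q ` Y" for U
        using that Y(2) PQ \<P> unfolding separating_opens_def by blast
    qed
    show "C \<subseteq> \<Union> (Q ` Y) \<union> G"
      using Y by blast
    have "P y \<inter> Q y = {}" if "y \<in> Y" for y
      using PQ Y(2) that by blast
    then show "\<Inter> (P ` Y) \<inter> \<Union> (Q ` Y) = {}"
      by blast
  qed
qed

text \<open>With the whole space as the compact part, the preceding separation puts the finite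
  intersection inside \<open>U\<close>. Intersecting with \<open>topspace X\<close> accounts for
  empty \<open>F\<close>.\<close>

lemma base_of_finite_Int_separating_opens:
  assumes "compact_space X" and \<P>: "separating_opens X \<P>"
  shows "base_of X ((\<lambda>F. topspace X \<inter> \<Inter>F) ` Fpow \<P>)"
  unfolding base_of_def
proof (intro conjI ballI allI impI)
  show "openin X V" if "V \<in> (\<lambda>F. topspace X \<inter> \<Inter>F) ` Fpow \<P>" for V
    using that \<P> by (auto simp: Fpow_def separating_opens_def intro!: openin_finite_Int)
next
  fix U assume U: "openin X U"
  have "\<exists>F\<in>Fpow \<P>. c \<in> topspace X \<inter> \<Inter>F \<and> topspace X \<inter> \<Inter>F \<subseteq> U" if "c \<in> U" for c
  proof -
    have c: "c \<in> topspace X" using that openin_subset[OF U] by blast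
    have "compactin X (topspace X)"
      using assms(1) by (simp add: compact_space_def)
    from separate_point_from_compact_part[OF \<P> this U c that] obtain F V where
      "F \<in> Fpow \<P>" "c \<in> \<Inter>F" "topspace X \<subseteq> V \<union> U" "\<Inter>F \<inter> V = {}" .
    with c show ?thesis by (intro bexI[of _ F]) blast+
  qed
  then obtain F where F: "\<And>c. c \<in> U \<Longrightarrow>
      F c \<in> Fpow \<P> \<and> c \<in> topspace X \<inter> \<Inter>(F c) \<and> topspace X \<inter> \<Inter>(F c) \<subseteq> U"
    by metis
  then have "U = \<Union> ((\<lambda>F. topspace X \<inter> \<Inter>F) ` F ` U)"
    by fastforce
  moreover have "(\<lambda>F. topspace X \<inter> \<Inter>F) ` F ` U \<subseteq> (\<lambda>F. topspace X \<inter> \<Inter>F) ` Fpow \<P>"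
    using F by (intro image_mono) auto
  ultimately show "\<exists>\<C>\<subseteq>(\<lambda>F. topspace X \<inter> \<Inter>F) ` Fpow \<P>. U = \<Union>\<C>"
    by (intro exI[of _ "(\<lambda>F. topspace X \<inter> \<Inter>F) ` F ` U"] conjI)
qed

subsection \<open>Lindelof Sigma-spaces\<close>

text \<open>The sets in \<open>\<M>\<close> are images under \<open>f\<close> of
  \<open>p\<close>-preimages of basic open sets of \<open>M\<close>, and \<open>C\<close> is the
  image of a fibre of \<open>p\<close>. Fibres are compact, and since \<open>p\<close> is closed,
  every open set around a fibre contains the preimage of a neighbourhood of the corresponding
  point.\<close>

lemma Lindelof_Sigma_space_compact_network:
  assumes "Lindelof_Sigma_space TYPE('l) TYPE('m) X"
  obtains \<M> where "countable \<M>"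
    "\<And>x. x \<in> topspace X \<Longrightarrow> \<exists>C. compactin X C \<and> x \<in> C \<and>
       (\<forall>G. openin X G \<and> C \<subseteq> G \<longrightarrow> (\<exists>N\<in>\<M>. C \<subseteq> N \<and> N \<subseteq> G))"
proof -
  obtain L :: "'l topology" and f where "Lindelof_p_space TYPE('m) L"
    and f: "continuous_map L X f" "f ` topspace L = topspace X"
    using assms unfolding Lindelof_Sigma_space_def by blast
  then obtain M :: "'m topology" and p where "second_countable M" and p: "perfect_map L M p"
    unfolding Lindelof_p_space_def by blast
  then obtain \<B> where "countable \<B>" and
    \<B>: "\<And>U x. openin M U \<Longrightarrow> x \<in> U \<Longrightarrow> \<exists>V\<in>\<B>. x \<in> V \<and> V \<subseteq> U"
    unfolding second_countable_def by metis
  let ?N = "\<lambda>V. f ` {l \<in> topspace L. p l \<in> V}"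
  show thesis
  proof
    show "countable (?N ` \<B>)"
      using \<open>countable \<B>\<close> by simp
  next
    fix x assume "x \<in> topspace X"
    then obtain l where l: "l \<in> topspace L" "f l = x"
      using f(2) by (metis imageE)
    have "p l \<in> topspace M"
      using l p perfect_imp_continuous_map continuous_map_def by (metis Pi_iff)
    define A where "A = {l' \<in> topspace L. p l' = p l}"
    have "compactin L A"
      using p \<open>p l \<in> topspace M\<close> perfect_imp_proper_map unfolding A_def proper_map_def by blast
    have "\<exists>N\<in>?N ` \<B>. f ` A \<subseteq> N \<and> N \<subseteq> G" if G: "openin X G" "f ` A \<subseteq> G" for G
    proof -
      have "openin L {l \<in> topspace L. f l \<in> G}" "A \<subseteq> {l \<in> topspace L. f l \<in> G}"
        using G f(1) by (auto simp: A_def openin_continuous_map_preimage)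
      moreover have "closed_map L M p"
        using p perfect_imp_closed_map by blast
      ultimately obtain V where "openin M V" "p l \<in> V"
        "{l \<in> topspace L. p l \<in> V} \<subseteq> {l \<in> topspace L. f l \<in> G}"
        using \<open>p l \<in> topspace M\<close> unfolding closed_map_fibre_neighbourhood A_def by blast
      moreover obtain W where "W \<in> \<B>" "p l \<in> W" "W \<subseteq> V"
        using \<B>[OF \<open>openin M V\<close> \<open>p l \<in> V\<close>] by blast
      ultimately show ?thesis
        by (intro bexI[of _ "?N W"]) (auto simp: A_def)
    qed
    moreover have "compactin X (f ` A)" "x \<in> f ` A"
      using image_compactin[OF \<open>compactin L A\<close> f(1)] l by (auto simp: A_def)
    ultimately show "\<exists>C. compactin X C \<and> x \<in> C \<and>
        (\<forall>G. openin X G \<and> C \<subseteq> G \<longrightarrow> (\<exists>N\<in>?N ` \<B>. C \<subseteq> N \<and> N \<subseteq> G))"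
      by blast
  qed
qed

text \<open>Disjoint open neighbourhoods are chosen once for each pair of network members that
  admits them. Members squeezed between two points and their disjoint neighbourhoods form such a
  pair, so \<open>\<kappa>\<close> choices suffice.\<close>

lemma network_of_separating_opens:
  assumes "Hausdorff_space X" and \<N>: "network_of X \<N>"
    and \<kappa>: "Cinfinite \<kappa>" "|\<N>| \<le>o \<kappa>"
  obtains \<P> where "separating_opens X \<P>" "|\<P>| \<le>o \<kappa>"
proof -
  define R where "R = (\<lambda>(N1, N2) (U, V). openin X U \<and> openin X V \<and> U \<inter> V = {} \<and> N1 \<subseteq> U \<and> N2 \<subseteq> V)"
  define D where "D = {n \<in> \<N> \<times> \<N>. \<exists>u. R n u}"
  define s where "s = (\<lambda>n. SOME u. R n u)"
  have s: "R n (s n)" if "n \<in> D" for n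
    unfolding s_def using that by (intro someI_ex[of "R n"]) (simp add: D_def)
  have net: "\<exists>N\<in>\<N>. x \<in> N \<and> N \<subseteq> U" if "openin X U" "x \<in> U" for x U
    using \<N> that unfolding network_of_def by blast
  show thesis
  proof
    show "separating_opens X ((fst \<circ> s) ` D \<union> (snd \<circ> s) ` D)"
      unfolding separating_opens_def
    proof (intro conjI ballI impI)
      show "openin X P" if "P \<in> (fst \<circ> s) ` D \<union> (snd \<circ> s) ` D" for P
        using that s by (fastforce simp: R_def split: prod.splits)
    next
      fix x y assume "x \<in> topspace X" "y \<in> topspace X" "x \<noteq> y"
      then obtain U V where UV: "openin X U" "openin X V" "x \<in> U" "y \<in> V" "U \<inter> V = {}"
        using assms(1) unfolding Hausdorff_space_def disjnt_def by metis
      obtain N1 N2 where N: "N1 \<in> \<N>" "x \<in> N1" "N1 \<subseteq> U" "N2 \<in> \<N>" "y \<in> N2" "N2 \<subseteq> V"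
        using net UV by metis
      then have "(N1, N2) \<in> D"
        using UV by (auto simp: D_def R_def)
      moreover from s[OF this] N have "x \<in> fst (s (N1, N2))" "y \<in> snd (s (N1, N2))"
        "fst (s (N1, N2)) \<inter> snd (s (N1, N2)) = {}"
        by (auto simp: R_def split: prod.splits)
      ultimately show "\<exists>P\<in>(fst \<circ> s) ` D \<union> (snd \<circ> s) ` D. \<exists>Q\<in>(fst \<circ> s) ` D \<union> (snd \<circ> s) ` D.
          x \<in> P \<and> y \<in> Q \<and> P \<inter> Q = {}"
        by (intro bexI[of _ "fst (s (N1, N2))"] bexI[of _ "snd (s (N1, N2))"]) force+
    qed
    have "|D| \<le>o \<kappa>"
      by (rule ordLeq_transitive[OF card_of_mono1 card_of_Times_ordLeq_Cinfinite[OF \<kappa> \<kappa>(2)]])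
        (auto simp: D_def)
    \<comment> \<open>Indexing the two projections by the booleans lets the bound for indexed unions
      apply.\<close>
    then have "|\<Union>b\<in>UNIV. (if b then fst \<circ> s else snd \<circ> s) ` D| \<le>o \<kappa>"
      by (intro card_of_image_ordLeq
          card_of_UN_ordLeq_Cinfinite[OF \<kappa>(1) countable_ordLeq_Cinfinite[OF \<kappa>(1) countableI_type]])
    then show "|(fst \<circ> s) ` D \<union> (snd \<circ> s) ` D| \<le>o \<kappa>"
      by (simp add: UNIV_bool Un_commute)
  qed
qed

text \<open>Rational values and tolerances indexed by naturals keep the number of constraints over a
  family of at most \<kappa> sets within \<kappa>, for infinite \<kappa>.\<close>

definition approximates :: "('a set \<times> rat \<times> nat) set \<Rightarrow> ('a \<Rightarrow> real) \<Rightarrow> bool" where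
  "approximates F g \<longleftrightarrow> (\<forall>(Q, q, k)\<in>F. \<forall>z\<in>Q. \<bar>g z - of_rat q\<bar> < inverse (real (Suc k)))"

text \<open>Around a point of the compact set \<open>C\<close>, a finite intersection of separating
  sets controls \<open>g\<close> only inside some \<open>V c \<union> G c\<close>. Finitely many
  such intersections cover \<open>C\<close>, and a member \<open>N\<close> of \<open>\<M>\<close>
  fits into their union and into all the sets \<open>V c \<union> G c\<close> involved. Cutting with
  \<open>N\<close> then yields full control.\<close>

lemma Lindelof_Sigma_space_approximation:
  assumes "Lindelof_Sigma_space TYPE('l) TYPE('m) X" and \<N>: "network_of X \<N>"
    and \<kappa>: "Cinfinite \<kappa>" "|\<N>| \<le>o \<kappa>"
  obtains \<Q> \<M> where "|\<Q>| \<le>o \<kappa>" "countable \<M>"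
    "\<And>g x k. continuous_map X euclideanreal g \<Longrightarrow> x \<in> topspace X \<Longrightarrow>
      \<exists>N\<in>\<M>. x \<in> N \<and> (\<exists>F\<in>Fpow (\<Q> \<times> UNIV \<times> {k}). N \<subseteq> \<Union> (fst ` F) \<and> approximates F g)"
proof -
  have "Hausdorff_space X"
    using assms(1) by (simp add: Lindelof_Sigma_space_def tychonoff_space_def)
  from network_of_separating_opens[OF this \<N> \<kappa>]
  obtain \<P> where \<P>: "separating_opens X \<P>" "|\<P>| \<le>o \<kappa>" .
  obtain \<M> where "countable \<M>" and \<M>: "\<And>x. x \<in> topspace X \<Longrightarrow> \<exists>C. compactin X C \<and> x \<in> C \<and>
      (\<forall>G. openin X G \<and> C \<subseteq> G \<longrightarrow> (\<exists>N\<in>\<M>. C \<subseteq> N \<and> N \<subseteq> G))"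
    by (rule Lindelof_Sigma_space_compact_network[OF assms(1)]) (rule that)
  \<comment> \<open>This family is fixed before \<open>g\<close> and \<open>x\<close>, which is what
    allows one bound on its size.\<close>
  define \<Q> where "\<Q> = (\<lambda>(F, N). topspace X \<inter> \<Inter>F \<inter> N) ` (Fpow \<P> \<times> \<M>)"
  show thesis
  proof
    show "|\<Q>| \<le>o \<kappa>"
      unfolding \<Q>_def
      by (intro card_of_image_ordLeq card_of_Times_ordLeq_Cinfinite[OF \<kappa>(1)]
          card_of_Fpow_ordLeq_Cinfinite[OF \<kappa>(1) \<P>(2)]
          countable_ordLeq_Cinfinite[OF \<kappa>(1) \<open>countable \<M>\<close>])
    show "countable \<M>" by fact
  next
    fix g :: "'a \<Rightarrow> real" and x and k :: nat
    assume g: "continuous_map X euclideanreal g" and "x \<in> topspace X"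
    from \<M>[OF this(2)] obtain C where C: "compactin X C" "x \<in> C"
      and CN: "\<And>G. openin X G \<Longrightarrow> C \<subseteq> G \<Longrightarrow> \<exists>N\<in>\<M>. C \<subseteq> N \<and> N \<subseteq> G" by blast
    have "C \<subseteq> topspace X" using C compactin_subset_topspace by blast
    define e where "e = inverse (real (Suc k))"
    have "\<exists>q. \<bar>g c - of_rat q\<bar> < e" for c
    proof -
      have "g c - e < g c + e" by (simp add: e_def)
      from of_rat_dense[OF this] show ?thesis by (auto simp: abs_less_iff algebra_simps)
    qed
    then obtain q where q: "\<And>c. \<bar>g c - of_rat (q c)\<bar> < e" by metis
    define G where "G = (\<lambda>c. {z \<in> topspace X. g z \<in> ball (of_rat (q c)) e})"
    have G: "openin X (G c)" for c
      unfolding G_def using g by (intro openin_continuous_map_preimage) auto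
    have "\<exists>F V. F \<in> Fpow \<P> \<and> c \<in> \<Inter>F \<and> openin X V \<and> C \<subseteq> V \<union> G c \<and> \<Inter>F \<inter> V = {}" if "c \<in> C" for c
    proof -
      have "c \<in> G c"
        using q[of c] that \<open>C \<subseteq> topspace X\<close> by (auto simp: G_def dist_real_def)
      from separate_point_from_compact_part[OF \<P>(1) C(1) G that this] show ?thesis by metis
    qed
    then obtain F V where FV: "\<And>c. c \<in> C \<Longrightarrow>
        F c \<in> Fpow \<P> \<and> c \<in> \<Inter>(F c) \<and> openin X (V c) \<and> C \<subseteq> V c \<union> G c \<and> \<Inter>(F c) \<inter> V c = {}"
      by metis
    define W where "W = (\<lambda>c. topspace X \<inter> \<Inter>(F c))"
    have W: "openin X (W c)" if "c \<in> C" for c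
      unfolding W_def using FV[OF that] \<P>(1)
      by (intro openin_finite_Int) (auto simp: Fpow_def separating_opens_def)
    have "\<forall>U\<in>W ` C. openin X U" "C \<subseteq> \<Union> (W ` C)"
      using W FV \<open>C \<subseteq> topspace X\<close> by (auto simp: W_def)
    then obtain \<F> where "finite \<F>" "\<F> \<subseteq> W ` C" "C \<subseteq> \<Union>\<F>"
      using C(1) unfolding compactin_def by meson
    then obtain Y where Y: "finite Y" "Y \<subseteq> C" "C \<subseteq> \<Union> (W ` Y)"
      by (metis finite_subset_image)
    \<comment> \<open>Finiteness of \<open>Y\<close> keeps the intersection of these sets open, so
      it may be used to select \<open>N\<close>.\<close>
    let ?H = "(\<lambda>c. V c \<union> G c) ` Y"
    have "openin X (\<Union> (W ` Y))"
      using Y(2) W by (intro openin_Union) auto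
    moreover have "openin X (topspace X \<inter> \<Inter>?H)"
      using Y(1,2) FV G by (intro openin_finite_Int) (auto intro!: openin_Un)
    ultimately have "openin X (\<Union> (W ` Y) \<inter> (topspace X \<inter> \<Inter>?H))"
      by (rule openin_Int)
    moreover have "C \<subseteq> \<Union> (W ` Y) \<inter> (topspace X \<inter> \<Inter>?H)"
      using Y FV \<open>C \<subseteq> topspace X\<close> by blast
    ultimately obtain N where N: "N \<in> \<M>" "C \<subseteq> N" "N \<subseteq> \<Union> (W ` Y) \<inter> (topspace X \<inter> \<Inter>?H)"
      using CN by meson
    define E where "E = (\<lambda>c. (W c \<inter> N, q c, k)) ` Y"
    have "W c \<inter> N \<in> \<Q>" if "c \<in> Y" for c
      unfolding \<Q>_def W_def using N(1) FV[of c] that Y(2) by (intro image_eqI[of _ _ "(F c, N)"]) auto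
    then have "E \<in> Fpow (\<Q> \<times> UNIV \<times> {k})"
      using Y(1) by (auto simp: E_def Fpow_def)
    moreover have "N \<subseteq> \<Union> (fst ` E)"
      using N(3) by (auto simp: E_def)
    moreover have "approximates E g"
    proof -
      have "\<bar>g z - of_rat (q c)\<bar> < e" if "c \<in> Y" "z \<in> W c \<inter> N" for c z
      proof -
        have "c \<in> C" using that(1) Y(2) by blast
        then have "\<Inter>(F c) \<inter> V c = {}" using FV by blast
        moreover have "z \<in> \<Inter>(F c)" using that(2) unfolding W_def by blast
        moreover have "z \<in> V c \<union> G c" using that N(3) by blast
        ultimately have "z \<in> G c" by blast
        then show ?thesis
          by (simp add: G_def dist_real_def abs_minus_commute)
      qed
      then show ?thesis
        by (auto simp: approximates_def E_def e_def)
    qed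
    ultimately show "\<exists>N\<in>\<M>. x \<in> N \<and> (\<exists>F\<in>Fpow (\<Q> \<times> UNIV \<times> {k}). N \<subseteq> \<Union> (fst ` F) \<and> approximates F g)"
      using N C(2) by blast
  qed
qed

subsection \<open>A small family of affine functions separating points\<close>

lemma approximates_close:
  assumes "approximates F g" "approximates F d" "(Q, q, k) \<in> F" "z \<in> Q"
  shows "\<bar>d z - g z\<bar> < 2 * inverse (real (Suc k))"
proof -
  have "\<bar>g z - of_rat q\<bar> < inverse (real (Suc k))" "\<bar>d z - of_rat q\<bar> < inverse (real (Suc k))"
    using assms by (auto simp: approximates_def)
  then show ?thesis by linarith
qed

text \<open>The boundary property applied to \<open>g\<close> and to \<open>- g\<close> yields
  attained extrema.\<close>

lemma continuous_affine_functions_bounded: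
  assumes bd: "boundary_of T K B" and g: "g \<in> continuous_affine_functions T K"
  obtains m :: nat where "\<And>x. x \<in> K \<Longrightarrow> \<bar>g x\<bar> \<le> real m"
proof -
  obtain b where b: "\<And>x. x \<in> K \<Longrightarrow> g x \<le> g b"
    using bd g unfolding boundary_of_def by blast
  obtain c where c: "\<And>x. x \<in> K \<Longrightarrow> - 1 * g x \<le> - 1 * g c"
    using bspec[OF conjunct2[OF bd[unfolded boundary_of_def]]
        continuous_affine_functions_mult[OF g, of "- 1"]] by blast
  obtain m :: nat where "max \<bar>g b\<bar> \<bar>g c\<bar> \<le> real m"
    using real_arch_simple by blast
  then have "\<bar>g x\<bar> \<le> real m" if "x \<in> K" for x
    using b[OF that] c[OF that] by (auto simp: abs_le_iff)
  then show thesis by (rule that)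
qed

text \<open>If every member of \<open>D\<close> agreed at \<open>x\<close> and \<open>y\<close>, so
  would each limit on \<open>K\<close> of a sequence from \<open>D\<close>. A separating
  \<open>g\<close> is such a limit: convergence on \<open>B\<close> comes from the constraints, and
  the common bound \<open>m\<close> allows passage to \<open>K\<close>.\<close>

lemma small_separating_affine_functions:
  fixes T :: "'a::real_vector topology"
  assumes K: "convex_compactum T K" and bd: "boundary_of T K B"
    and "Cinfinite \<kappa>" "|\<Q>| \<le>o \<kappa>" "countable \<M>"
    and approx: "\<And>g x k. continuous_map (subtopology T B) euclideanreal g \<Longrightarrow> x \<in> B \<Longrightarrow>
      \<exists>N\<in>\<M>. x \<in> N \<and> (\<exists>F\<in>Fpow (\<Q> \<times> UNIV \<times> {k}). N \<subseteq> \<Union> (fst ` F) \<and> approximates F g)"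
  obtains D where "D \<subseteq> continuous_affine_functions T K" "|D| \<le>o \<kappa>"
    "\<And>x y. x \<in> K \<Longrightarrow> y \<in> K \<Longrightarrow> x \<noteq> y \<Longrightarrow> \<exists>d\<in>D. d x \<noteq> d y"
proof -
  have "convex K" using K by (simp add: convex_compactum_def)
  have "B \<subseteq> K" using bd by (simp add: boundary_of_def)
  define \<A> where "\<A> = continuous_affine_functions T K"
  define S where "S = (\<lambda>(m::nat, F). {g \<in> \<A>. (\<forall>x\<in>K. \<bar>g x\<bar> \<le> real m) \<and> approximates F g})"
  define I where "I = (UNIV :: nat set) \<times> Fpow (\<Q> \<times> (UNIV :: rat set) \<times> (UNIV :: nat set))"
  define pick where "pick = (\<lambda>i. SOME g. g \<in> S i)"
  have pick: "pick i \<in> S i" if "g \<in> S i" for g i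
    unfolding pick_def using that by (rule someI[where P = "\<lambda>g. g \<in> S i"])
  define D where "D = pick ` {i \<in> I. S i \<noteq> {}}"
  have pickD: "pick i \<in> D" if "i \<in> I" "g \<in> S i" for g i
    using that by (auto simp: D_def)
  have "D \<subseteq> \<A>"
    using pick by (fastforce simp: D_def S_def)
  then have "D \<subseteq> continuous_affine_functions T K"
    by (simp only: \<A>_def)
  moreover have "|D| \<le>o \<kappa>"
  proof -
    have "|I| \<le>o \<kappa>"
      unfolding I_def
      by (intro card_of_Times_ordLeq_Cinfinite[OF assms(3)] card_of_Fpow_ordLeq_Cinfinite[OF assms(3)]
          countable_ordLeq_Cinfinite[OF assms(3) countableI_type] assms(4))
    then have "|{i \<in> I. S i \<noteq> {}}| \<le>o \<kappa>"
      by (rule ordLeq_transitive[OF card_of_mono1, rotated]) auto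
    then show ?thesis
      unfolding D_def by (rule card_of_image_ordLeq)
  qed
  moreover have "\<exists>d\<in>D. d x \<noteq> d y" if "x \<in> K" "y \<in> K" "x \<noteq> y" for x y
  proof -
    obtain g where g: "g \<in> \<A>" "g x \<noteq> g y"
      using continuous_affine_functions_separate[OF K \<open>x \<noteq> y\<close>] unfolding \<A>_def .
    obtain m where m: "\<And>z. z \<in> K \<Longrightarrow> \<bar>g z\<bar> \<le> real m"
      using continuous_affine_functions_bounded[OF bd] g(1) unfolding \<A>_def by blast
    have gB: "continuous_map (subtopology T B) euclideanreal g"
      using continuous_affine_functionsD(1) g(1) \<open>B \<subseteq> K\<close> unfolding \<A>_def
      by (metis continuous_map_from_subtopology_mono)
    define R where "R = (\<lambda>(N, k) F. F \<in> Fpow (\<Q> \<times> UNIV \<times> {k}) \<and> N \<subseteq> \<Union> (fst ` F) \<and> approximates F g)"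
    \<comment> \<open>Each pair consists of a network member and a precision, so countability of
      \<open>\<M>\<close> makes one sequence of constraint systems sufficient for all points of
      \<open>B\<close> and all precisions.\<close>
    define P where "P = {p \<in> \<M> \<times> UNIV. \<exists>F. R p F}"
    have "\<exists>F. \<forall>p\<in>P. R p (F p)"
      by (rule bchoice) (simp add: P_def)
    then obtain F where F: "\<And>p. p \<in> P \<Longrightarrow> R p (F p)" by blast
    have inP: "\<exists>N. (N, k) \<in> P \<and> b \<in> N" if "b \<in> B" for b k
      using approx[OF gB that, of k] by (fastforce simp: P_def R_def)
    have "countable P"
      by (rule countable_subset[of _ "\<M> \<times> UNIV"]) (auto simp: P_def assms(5))
    \<comment> \<open>A maximum point of \<open>g\<close> shows that \<open>B\<close>, and hence
      \<open>P\<close>, is nonempty, as the enumeration of \<open>P\<close> by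
      \<open>from_nat_into\<close> requires.\<close>
    obtain b where "b \<in> B" using bd g(1) by (auto simp: boundary_of_def \<A>_def)
    with inP have "P \<noteq> {}" by blast
    define t where "t = from_nat_into P"
    have tP: "t n \<in> P" for n
      unfolding t_def by (rule from_nat_into[OF \<open>P \<noteq> {}\<close>])
    \<comment> \<open>The systems accumulate, so every constraint met once binds all later
      \<open>d n\<close>. Each system is satisfiable with bound \<open>m\<close>, since
      \<open>g\<close> itself satisfies it.\<close>
    define E where "E = (\<lambda>n. \<Union>i\<le>n. F (t i))"
    have FtP: "F (t i) \<in> Fpow (\<Q> \<times> UNIV \<times> UNIV)" "approximates (F (t i)) g" for i
      using F[OF tP[of i]] by (auto simp: R_def Fpow_def split: prod.splits)
    have E: "(m, E n) \<in> I" for n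
      using FtP(1) by (fastforce simp: I_def E_def Fpow_def)
    have gE: "g \<in> S (m, E n)" for n
      using FtP(2) g(1) m by (fastforce simp: S_def E_def approximates_def)
    define d where "d = (\<lambda>n. pick (m, E n))"
    have dS: "d n \<in> S (m, E n)" and dD: "d n \<in> D" for n
      unfolding d_def using pick[OF gE] pickD[OF E gE] by blast+
    have lim: "(\<lambda>n. d n b) \<longlonglongrightarrow> g b" if b: "b \<in> B" for b
    proof (rule LIMSEQ_I)
      fix r :: real assume "r > 0"
      \<comment> \<open>The half of \<open>r\<close> is needed because \<open>d n\<close> and
        \<open>g\<close> are each compared with the same rational.\<close>
      then obtain k where k: "inverse (real (Suc k)) < r / 2"
        using reals_Archimedean[of "r / 2"] by auto
      obtain N where N: "(N, k) \<in> P" "b \<in> N" using inP[OF b] by blast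
      then obtain i where i: "t i = (N, k)"
        using from_nat_into_surj[OF \<open>countable P\<close>] unfolding t_def by metis
      then obtain Q q where Q: "(Q, q, k) \<in> F (t i)" "b \<in> Q"
        using F[OF N(1)] N(2) by (fastforce simp: R_def Fpow_def)
      have "norm (d n b - g b) < r" if "n \<ge> i" for n
      proof -
        have "(Q, q, k) \<in> E n"
          using Q(1) that by (auto simp: E_def)
        moreover have "approximates (E n) g" "approximates (E n) (d n)"
          using gE[of n] dS[of n] by (auto simp: S_def)
        ultimately have "\<bar>d n b - g b\<bar> < 2 * inverse (real (Suc k))"
          using Q(2) approximates_close by metis
        then show ?thesis using k by simp
      qed
      then show "\<exists>no. \<forall>n\<ge>no. norm (d n b - g b) < r" by blast
    qed
    have conv: "(\<lambda>n. d n z) \<longlonglongrightarrow> g z" if "z \<in> K" for z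
    proof (rule boundary_pointwise_convergence[OF \<open>convex K\<close> bd])
      show "d n \<in> continuous_affine_functions T K" "\<And>w. w \<in> K \<Longrightarrow> \<bar>d n w\<bar> \<le> real m" for n
        using dS[of n] by (auto simp: S_def \<A>_def)
    qed (use g(1) m lim that in \<open>auto simp: \<A>_def\<close>)
    show ?thesis
    proof (rule ccontr)
      assume "\<not> (\<exists>d\<in>D. d x \<noteq> d y)"
      then have "d n x = d n y" for n using dD by blast
      then have "g x = g y"
        using conv[OF \<open>x \<in> K\<close>] conv[OF \<open>y \<in> K\<close>] LIMSEQ_unique by simp
      with g(2) show False by simp
    qed
  qed
  ultimately show thesis
    by (rule that)
qed

section \<open>Weight of a compact space with few separating functions\<close>

text \<open>Sublevel and superlevel sets at a rational strictly between \<open>d x\<close> and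
  \<open>d y\<close> separate \<open>x\<close> and \<open>y\<close>. There are at most
  \<open>\<kappa>\<close> of these sets, and by compactness their finite intersections form a
  base.\<close>

lemma weight_ordLeq_separating_functions:
  assumes "compact_space X" "Cinfinite \<kappa>" "|D| \<le>o \<kappa>"
    and cont: "\<And>d. d \<in> D \<Longrightarrow> continuous_map X euclideanreal d"
    and sep: "\<And>x y. x \<in> topspace X \<Longrightarrow> y \<in> topspace X \<Longrightarrow> x \<noteq> y \<Longrightarrow> \<exists>d\<in>D. d x \<noteq> d y"
  shows "weight X \<le>o \<kappa>"
proof -
  define L where "L = (\<lambda>(d, q). {x \<in> topspace X. d x \<in> {..<real_of_rat q}})"
  define U where "U = (\<lambda>(d, q). {x \<in> topspace X. d x \<in> {real_of_rat q<..}})"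
  define \<P> where "\<P> = (\<Union>f\<in>{L, U}. f ` (D \<times> UNIV))"
  have "separating_opens X \<P>"
    unfolding separating_opens_def
  proof (intro conjI ballI impI)
    fix P assume "P \<in> \<P>"
    then obtain d q where "d \<in> D" "P = L (d, q) \<or> P = U (d, q)"
      by (auto simp: \<P>_def)
    then show "openin X P"
      using openin_continuous_map_preimage[OF cont, of d "{..<real_of_rat q}"]
        openin_continuous_map_preimage[OF cont, of d "{real_of_rat q<..}"]
      by (auto simp: L_def U_def)
  next
    fix x y assume xy: "x \<in> topspace X" "y \<in> topspace X" "x \<noteq> y"
    then obtain d where "d \<in> D" "d x \<noteq> d y" using sep by blast
    have mem: "L (d, q) \<in> \<P>" "U (d, q) \<in> \<P>" for q
      using \<open>d \<in> D\<close> by (auto simp: \<P>_def)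
    have disj: "L (d, q) \<inter> U (d, q) = {}" for q
      by (auto simp: L_def U_def)
    consider "d x < d y" | "d y < d x" using \<open>d x \<noteq> d y\<close> by linarith
    then show "\<exists>P\<in>\<P>. \<exists>Q\<in>\<P>. x \<in> P \<and> y \<in> Q \<and> P \<inter> Q = {}"
    proof cases
      case 1
      then obtain q where "d x < of_rat q" "of_rat q < d y" using of_rat_dense by blast
      then have "x \<in> L (d, q)" "y \<in> U (d, q)" using xy by (auto simp: L_def U_def)
      then show ?thesis
        by (intro bexI[of _ "L (d, q)"] bexI[of _ "U (d, q)"] conjI mem disj)
    next
      case 2
      then obtain q where "d y < of_rat q" "of_rat q < d x" using of_rat_dense by blast
      then have "x \<in> U (d, q)" "y \<in> L (d, q)" using xy by (auto simp: L_def U_def)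
      moreover have "U (d, q) \<inter> L (d, q) = {}" using disj[of q] by blast
      ultimately show ?thesis
        by (intro bexI[of _ "U (d, q)"] bexI[of _ "L (d, q)"] conjI mem)
    qed
  qed
  from base_of_finite_Int_separating_opens[OF assms(1) this]
  have base: "base_of X ((\<lambda>F. topspace X \<inter> \<Inter>F) ` Fpow \<P>)" .
  have "|\<P>| \<le>o \<kappa>"
    unfolding \<P>_def
    by (intro card_of_UN_ordLeq_Cinfinite[OF assms(2)] card_of_image_ordLeq
        card_of_Times_ordLeq_Cinfinite[OF assms(2,3)] countable_ordLeq_Cinfinite[OF assms(2)]) auto
  then have "|(\<lambda>F. topspace X \<inter> \<Inter>F) ` Fpow \<P>| \<le>o \<kappa>"
    by (intro card_of_image_ordLeq card_of_Fpow_ordLeq_Cinfinite[OF assms(2)])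
  then have "min_card (base_of X) \<le>o \<kappa>"
    by (rule ordLeq_transitive[OF min_card(2)[of "base_of X", OF base base]])
  moreover obtain A where "min_card (base_of X) = |A|"
    using min_card(1)[of "base_of X", OF base] by blast
  ultimately show ?thesis
    unfolding weight_def using assms(2)
    by (intro csum_cinfinite_bound natLeq_ordLeq_cinfinite natLeq_Card_order)
      (auto simp: card_of_Card_order)
qed

theorem mainTheorem2:
  fixes T :: "'a::real_vector topology" and K B :: "'a set"
  assumes "convex_compactum T K"
    and "boundary_of T K B"
    and "Lindelof_Sigma_space TYPE('l) TYPE('m) (subtopology T B)"
  shows "weight (subtopology T K) \<le>o network_weight (subtopology T B)"
proof -
  define \<kappa> where "\<kappa> = network_weight (subtopology T B)"
  obtain \<N> where \<N>: "network_of (subtopology T B) \<N>" "min_card (network_of (subtopology T B)) = |\<N>|"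
    using min_card(1)[of "network_of (subtopology T B)", OF base_of_imp_network_of[OF base_of_openin]] by blast
  have \<kappa>: "\<kappa> = |\<N>| +c natLeq"
    by (simp add: \<kappa>_def network_weight_def \<N>(2))
  \<comment> \<open>The summand \<open>natLeq\<close> makes \<open>\<kappa>\<close> infinite even
    when the network is finite, and the cardinal estimates rely on this.\<close>
  have inf: "Cinfinite \<kappa>"
    unfolding \<kappa> by (intro Cinfinite_csum disjI2 natLeq_Cinfinite)
  have "|\<N>| \<le>o \<kappa>"
    unfolding \<kappa> by (intro ordLeq_csum1 card_of_Card_order)
  have top: "topspace T = UNIV" and "compactin T K"
    using assms(1) by (auto simp: convex_compactum_def locally_convex_linear_space_def)
  obtain \<Q> \<M> where QM: "|\<Q>| \<le>o \<kappa>" "countable \<M>"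
    and approx: "\<And>g x k. continuous_map (subtopology T B) euclideanreal g \<Longrightarrow> x \<in> topspace (subtopology T B) \<Longrightarrow>
      \<exists>N\<in>\<M>. x \<in> N \<and> (\<exists>F\<in>Fpow (\<Q> \<times> UNIV \<times> {k}). N \<subseteq> \<Union> (fst ` F) \<and> approximates F g)"
    by (rule Lindelof_Sigma_space_approximation[OF assms(3) \<N>(1) inf \<open>|\<N>| \<le>o \<kappa>\<close>]) (rule that)
  obtain D where D: "D \<subseteq> continuous_affine_functions T K" "|D| \<le>o \<kappa>"
    "\<And>x y. x \<in> K \<Longrightarrow> y \<in> K \<Longrightarrow> x \<noteq> y \<Longrightarrow> \<exists>d\<in>D. d x \<noteq> d y"
  proof (rule small_separating_affine_functions[OF assms(1,2) inf QM])
    show "\<exists>N\<in>\<M>. x \<in> N \<and> (\<exists>F\<in>Fpow (\<Q> \<times> UNIV \<times> {k}). N \<subseteq> \<Union> (fst ` F) \<and> approximates F g)"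
      if "continuous_map (subtopology T B) euclideanreal g" "x \<in> B" for g x k
      using approx[OF that(1)] that(2) top by simp
  qed (rule that)
  have "weight (subtopology T K) \<le>o \<kappa>"
  proof (rule weight_ordLeq_separating_functions[OF _ inf D(2)])
    show "compact_space (subtopology T K)"
      using \<open>compactin T K\<close> by (simp add: compact_space_subtopology)
    show "continuous_map (subtopology T K) euclideanreal d" if "d \<in> D" for d
      using D(1) that by (intro continuous_affine_functionsD(1)) blast
  qed (use D(3) top in auto)
  then show ?thesis
    by (simp add: \<kappa>_def)
qed

end
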